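(* Let $G$ be a finite non-solvable group such that $Sub(G) = 59$. Then $G \cong A_5$, the alternating group on $5$ letters.
   Context: For a finite group $G$, $Sub(G)$ denotes the number of subgroups of $G$, including the trivial subgroup and $G$ itself (subgroups are counted as subsets, not up to conjugacy or isomorphism). *)

theory Defs
  imports "HOL-Algebra.Algebra"
begin

definition num_subgroups :: "('a, 'b) monoid_scheme \<Rightarrow> nat"
  where "num_subgroups G = card {H. subgroup H G}"

end

theory Submission
  imports Defs
begin

text \<open>
  The idea is to show that a nonabelian finite simple group has at least 59 subgroups, with equality
  only for the alternating group of degree five, and to reduce the general case to it.

  For the reduction, a minimal nonsolvable subgroup \<open>H\<close> of \<open>G\<close> modulo a maximal proper normal subgroup
  \<open>N\<close> is a nonabelian simple group. Its subgroups correspond to the subgroups of \<open>G\<close> between \<open>N\<close> and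
  \<open>H\<close>. So it has at most 59 subgroups, hence exactly 59, which forces \<open>H = G\<close> and \<open>N = 1\<close>
  (\<open>nonsolvable_simple_section\<close>, \<open>num_subgroups_section\<close>).

  Now let \<open>G\<close> be nonabelian simple of order \<open>g\<close> with at most 59 subgroups, and let \<open>s d\<close> be its number
  of subgroups of order \<open>d\<close>. The values \<open>s d\<close> for \<open>1 < d < g\<close> add up to at most 57, while each
  nonzero one is large: it is at least the size \<open>c\<close> of a conjugacy class, which is the index of a
  proper subgroup, so that \<open>G\<close> embeds into the alternating group of degree \<open>c\<close> and \<open>2 * g\<close> divides
  the factorial of \<open>c\<close> (\<open>order_dvd_fact_index\<close>). In particular \<open>c\<close> is at least the largest prime
  divisor \<open>L\<close> of \<open>g\<close>. Let \<open>n\<close> be the number of Sylow \<open>L\<close>-subgroups. Every prime power dividing \<open>n\<close>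
  is the order of a subgroup, so the sum of at most 57 and the congruence of \<open>n\<close> to 1 modulo \<open>L\<close>
  leave a few pairs \<open>(L, n)\<close> (\<open>largest_prime_cases\<close>). These are treated one by one with Sylow's
  theorem, the normalisers of Sylow subgroups as further subgroups, and occasionally a count of
  elements of prime order (\<open>order_60\<close>).

  What survives is \<open>g = 60\<close> with a subgroup of index five, so \<open>G\<close> is the alternating group of degree
  five. Its 15 double transpositions complete the lower bounds for the \<open>s d\<close> to the sum 57.
\<close>

(* "prime" is the predicate on numbers, not the one on elements of a monoid. *)
hide_const (open) Divisibility.prime

section \<open>Fixed points of p-groups, conjugates and normalisers\<close>

text \<open>
  The points that are moved split into orbits whose sizes divide a power of \<open>p\<close> and exceed 1,
  hence are divisible by \<open>p\<close>.
\<close>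
lemma (in group_action) fixed_points_mod_prime:
  assumes E: "finite E" and p: "prime p" and ord: "order G = p ^ k"
  shows "card E mod p = card {x \<in> E. \<forall>g\<in>carrier G. \<phi> g x = x} mod p"
proof -
  let ?F = "{x \<in> E. \<forall>g\<in>carrier G. \<phi> g x = x}"
  have sub: "orbit G \<phi> x \<subseteq> E - ?F" if x: "x \<in> E - ?F" for x
  proof
    fix y assume y: "y \<in> orbit G \<phi> x"
    then have yE: "y \<in> E" using x element_image unfolding orbit_def by blast
    have "x \<in> orbit G \<phi> y" using orbit_sym[OF _ yE y] x by blast
    then have "x = y" if "y \<in> ?F" using that unfolding orbit_def by auto
    then show "y \<in> E - ?F" using x yE by blast
  qed
  have un: "(\<Union>x \<in> E - ?F. orbit G \<phi> x) = E - ?F"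
  proof
    show "(\<Union>x \<in> E - ?F. orbit G \<phi> x) \<subseteq> E - ?F" using sub by (rule UN_least)
    show "E - ?F \<subseteq> (\<Union>x \<in> E - ?F. orbit G \<phi> x)"
      using orbit_refl by (meson DiffD1 UN_I subsetI)
  qed
  have "p dvd card (\<Union>x \<in> E - ?F. orbit G \<phi> x)"
  proof (rule dvd_partition)
    show "finite (\<Union>x \<in> E - ?F. orbit G \<phi> x)" using un E by simp
  next
    show "\<forall>c1\<in>orbit G \<phi> ` (E - ?F). \<forall>c2\<in>orbit G \<phi> ` (E - ?F). c1 \<noteq> c2 \<longrightarrow> c1 \<inter> c2 = {}"
    proof (intro ballI impI)
      fix a b assume a: "a \<in> orbit G \<phi> ` (E - ?F)" and b: "b \<in> orbit G \<phi> ` (E - ?F)" and ne: "a \<noteq> b"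
      have "a \<in> orbits G E \<phi>" "b \<in> orbits G E \<phi>" using a b unfolding orbits_def by auto
      then show "a \<inter> b = {}" using disjoint_union ne by blast
    qed
  next
    show "\<forall>c\<in>orbit G \<phi> ` (E - ?F). p dvd card c"
    proof
      fix c assume "c \<in> orbit G \<phi> ` (E - ?F)"
      then obtain x where x: "x \<in> E" "x \<notin> ?F" and c: "c = orbit G \<phi> x" by blast
      then obtain g where g: "g \<in> carrier G" "\<phi> g x \<noteq> x" by blast
      have "card c dvd p ^ k" using orbit_stabilizer_theorem[OF x(1)] ord c
        by (metis dvd_triv_left)
      then obtain i where i: "card c = p ^ i" using divides_primepow_nat[OF p] by blast
      have "{x, \<phi> g x} \<subseteq> c" using orbit_refl[OF x(1)] g c unfolding orbit_def by blast
      moreover have "finite c" using sub[of x] x c E finite_subset by blast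
      ultimately have "card {x, \<phi> g x} \<le> card c" by (rule card_mono[rotated])
      then have "i \<noteq> 0" using g(2) i by (cases i) (auto simp: card_insert_if)
      then show "p dvd card c" using i by simp
    qed
  qed
  then have "p dvd card (E - ?F)" using un by simp
  moreover have "card E = card (E - ?F) + card ?F"
  proof -
    have "?F \<subseteq> E" by blast
    then show ?thesis using card_Diff_subset[of ?F E] card_mono[OF E, of ?F] E finite_subset[of ?F E] by linarith
  qed
  ultimately show ?thesis by (simp add: mod_add_left_eq[symmetric] mod_0_imp_dvd dvd_imp_mod_0)
qed

context group begin

text \<open>
  Right cosets need the inverse: \<open>K #> x\<close> goes to \<open>K #> x #> inv g\<close>, so that this is an action
  from the left. The stabiliser of \<open>K #> x\<close> is the conjugate of \<open>K\<close> by \<open>inv x\<close>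
  (\<open>coset_stabilizer_iff\<close>).
\<close>
lemma coset_action:
  assumes K: "subgroup K G"
  shows "group_action G (rcosets K) (\<lambda>g. \<lambda>C\<in>rcosets K. C #> inv g)"
proof -
  let ?\<phi> = "\<lambda>g. \<lambda>C\<in>rcosets K. C #> inv g"
  have sub: "C \<subseteq> carrier G" if "C \<in> rcosets K" for C
    using rcosets_subset_PowG[OF K] that by blast
  have cl: "C #> g \<in> rcosets K" if "C \<in> rcosets K" "g \<in> carrier G" for C g
  proof -
    from that(1) obtain x where x: "x \<in> carrier G" "C = K #> x" unfolding RCOSETS_def by blast
    have "C #> g = K #> (x \<otimes> g)"
      using coset_mult_assoc[OF subgroup.subset[OF K] x(1) that(2)] x(2) by simp
    then show ?thesis using x(1) that(2) rcosetsI[OF subgroup.subset[OF K]] by simp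
  qed
  have bij: "?\<phi> g \<in> Bij (rcosets K)" if g: "g \<in> carrier G" for g
  proof -
    have "bij_betw (?\<phi> g) (rcosets K) (rcosets K)"
    proof (rule bij_betw_byWitness[where f' = "\<lambda>C. C #> g"])
      show "\<forall>C\<in>rcosets K. ?\<phi> g C #> g = C"
        using coset_mult_assoc[OF sub] coset_mult_one[OF sub] g by simp
      show "\<forall>C\<in>rcosets K. ?\<phi> g (C #> g) = C"
        using coset_mult_assoc[OF sub] coset_mult_one[OF sub] g cl by simp
    qed (use g cl in \<open>simp_all add: image_subset_iff\<close>)
    then show ?thesis by (simp add: Bij_def)
  qed
  have hom: "?\<phi> (g \<otimes> h) = compose (rcosets K) (?\<phi> g) (?\<phi> h)" if gh: "g \<in> carrier G" "h \<in> carrier G" for g h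
  proof
    fix C
    show "?\<phi> (g \<otimes> h) C = compose (rcosets K) (?\<phi> g) (?\<phi> h) C"
    proof (cases "C \<in> rcosets K")
      case True
      then have "C #> inv h \<in> rcosets K" using cl gh by simp
      moreover have "C #> inv h #> inv g = C #> inv (g \<otimes> h)"
        using sub[OF True] gh by (simp add: inv_mult_group coset_mult_assoc)
      ultimately show ?thesis using True by (simp add: compose_def)
    qed (simp add: compose_def)
  qed
  have "?\<phi> \<in> hom G (BijGroup (rcosets K))"
    unfolding hom_def
  proof (intro CollectI conjI ballI Pi_I)
    show "?\<phi> g \<in> carrier (BijGroup (rcosets K))" if "g \<in> carrier G" for g
      using bij[OF that] by (simp add: BijGroup_def)
    show "?\<phi> (g \<otimes> h) = ?\<phi> g \<otimes>\<^bsub>BijGroup (rcosets K)\<^esub> ?\<phi> h" if "g \<in> carrier G" "h \<in> carrier G" for g h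
      unfolding hom[OF that] using bij that by (simp add: BijGroup_def)
  qed
  then show ?thesis
    by (intro group_action.intro group_hom.intro group_hom_axioms.intro is_group group_BijGroup)
qed

lemma coset_stabilizer_iff:
  assumes K: "subgroup K G" and x: "x \<in> carrier G" and h: "h \<in> carrier G"
  shows "K #> x #> inv h = K #> x \<longleftrightarrow> x \<otimes> h \<otimes> inv x \<in> K"
proof -
  have y: "x \<otimes> inv h \<in> carrier G" using x h by simp
  have "K #> x #> inv h = K #> (x \<otimes> inv h)"
    using coset_mult_assoc[OF subgroup.subset[OF K] x] h by simp
  moreover have "K #> (x \<otimes> inv h) = K #> x \<longleftrightarrow> x \<in> K #> (x \<otimes> inv h)"
    using repr_independence[OF _ y K, of x] rcos_self[OF x K] by metis
  moreover have "x \<in> K #> (x \<otimes> inv h) \<longleftrightarrow> x \<otimes> inv (x \<otimes> inv h) \<in> K"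
    using subgroup.rcos_module[OF K is_group y x] .
  moreover have "x \<otimes> inv (x \<otimes> inv h) = x \<otimes> h \<otimes> inv x"
    using x h by (simp add: inv_mult_group m_assoc)
  ultimately show ?thesis by simp
qed

lemma conjugate_eq:
  assumes "x \<in> carrier G" "H \<subseteq> carrier G"
  shows "x <# H #> inv x = (\<lambda>h. x \<otimes> h \<otimes> inv x) ` H"
  unfolding l_coset_def r_coset_def by auto

lemma card_conjugate:
  assumes "x \<in> carrier G" "H \<subseteq> carrier G"
  shows "card (x <# H #> inv x) = card H"
  unfolding conjugate_eq[OF assms]
  by (intro card_image inj_onI) (meson assms conjugation_is_inj subsetD)

lemma normalizer_iff:
  assumes "H \<subseteq> carrier G"
  shows "x \<in> normalizer G H \<longleftrightarrow> x \<in> carrier G \<and> x <# H #> inv x = H"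
  using assms by (simp add: normalizer_def stabilizer_def)

text \<open>
  Conjugation preserves cardinality, so for finite \<open>H\<close> an inclusion of the conjugate in \<open>H\<close> is
  already an equality.
\<close>
lemma normalizer_iff_finite:
  assumes "H \<subseteq> carrier G" "finite H"
  shows "x \<in> normalizer G H \<longleftrightarrow> x \<in> carrier G \<and> (\<forall>h\<in>H. x \<otimes> h \<otimes> inv x \<in> H)"
proof -
  have "x <# H #> inv x = H \<longleftrightarrow> x <# H #> inv x \<subseteq> H" if "x \<in> carrier G"
    using card_subset_eq[OF assms(2) _ card_conjugate[OF that assms(1)]] by blast
  moreover have "x <# H #> inv x \<subseteq> H \<longleftrightarrow> (\<forall>h\<in>H. x \<otimes> h \<otimes> inv x \<in> H)" if "x \<in> carrier G"
    unfolding conjugate_eq[OF that assms(1)] by blast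
  ultimately show ?thesis
    unfolding normalizer_iff[OF assms(1)] by blast
qed

lemma subgroup_in_normalizer:
  assumes "subgroup H G" shows "H \<subseteq> normalizer G H"
proof
  fix x assume x: "x \<in> H"
  have H: "H \<subseteq> carrier G" using subgroup.subset[OF assms] .
  have xG: "x \<in> carrier G" using H x by blast
  have "x <# H = H" using coset_join3[OF xG assms x] .
  moreover have "H #> inv x = H"
    using coset_join2[OF inv_closed[OF xG] assms subgroup.m_inv_closed[OF assms x]] .
  ultimately show "x \<in> normalizer G H" using xG normalizer_iff[OF H] by simp
qed

lemma subgroup_normalizer:
  assumes "subgroup H G" shows "subgroup (normalizer G H) G"
  using normalizer_imp_subgroup[OF subgroup.subset[OF assms]] .

lemma normal_if_normalizer_full:
  assumes "subgroup H G" "normalizer G H = carrier G"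
  shows "H \<lhd> G"
proof -
  have H: "H \<subseteq> carrier G" using subgroup.subset[OF assms(1)] .
  have "x \<otimes> h \<otimes> inv x \<in> H" if "x \<in> carrier G" "h \<in> H" for x h
  proof -
    have "x <# H #> inv x = H" using that assms(2) normalizer_iff[OF H, of x] by blast
    then show ?thesis using conjugate_eq[OF that(1) H] that(2) by blast
  qed
  then show ?thesis using normal_invI[OF assms(1)] by blast
qed

lemma card_subgroup_dvd: "subgroup H G \<Longrightarrow> card H dvd order G"
  using lagrange[of H] dvd_triv_right[of "card H" "card (rcosets H)"] by simp

lemma card_subgroup_dvd_subgroup:
  assumes "subgroup H G" "subgroup K G" "H \<subseteq> K"
  shows "card H dvd card K"
  using group.card_subgroup_dvd[OF subgroup_imp_group[OF assms(2)] subgroup_incl[OF assms]]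
  by (simp add: order_def)

definition conjugates where
  "conjugates H = (\<lambda>x. x <# H #> inv x) ` carrier G"

lemma card_conjugates:
  assumes "subgroup H G"
  shows "card (conjugates H) * card (normalizer G H) = order G"
proof -
  have H: "H \<subseteq> carrier G" using subgroup.subset[OF assms] .
  have "orbit G (\<lambda>g. \<lambda>H \<in> {H. H \<subseteq> carrier G}. g <# H #> (inv g)) H = conjugates H"
    using H unfolding orbit_def conjugates_def by (simp add: Setcompr_eq_image)
  then show ?thesis
    using group_action.orbit_stabilizer_theorem[OF action_by_conjugation_on_power_set, of H] H
    unfolding normalizer_def by simp
qed

lemma conjugates_subgroups:
  assumes "subgroup H G"
  shows "conjugates H \<subseteq> {K. subgroup K G \<and> card K = card H}"
  unfolding conjugates_def
  using subgroup_conjugation_is_surj2[OF _ assms] card_conjugate[OF _ subgroup.subset[OF assms]] by blast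

end

section \<open>Sylow's theorem with counts of normalisers\<close>

definition subgroup_count :: "('a, 'b) monoid_scheme \<Rightarrow> nat \<Rightarrow> nat" where
  "subgroup_count G d = card {H. subgroup H G \<and> card H = d}"

context group begin

lemma finite_subgroups:
  assumes "finite (carrier G)"
  shows "finite {H. subgroup H G \<and> P H}"
proof (rule finite_subset)
  show "{H. subgroup H G \<and> P H} \<subseteq> Pow (carrier G)" using subgroup.subset by blast
qed (use assms in simp)

lemma subgroup_count_pos:
  assumes "finite (carrier G)" "subgroup H G"
  shows "0 < subgroup_count G (card H)"
  unfolding subgroup_count_def
  using finite_subgroups[OF assms(1), of "\<lambda>K. card K = card H"] assms(2)
  by (subst card_gt_0_iff) blast

lemma subgroup_count_posD:
  assumes "0 < subgroup_count G d"
  obtains H where "subgroup H G" "card H = d"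
  using assms unfolding subgroup_count_def by (subst (asm) card_gt_0_iff) blast

text \<open>
  The \<open>p\<close>-group \<open>H\<close> acts on the cosets of \<open>K\<close>. Their number is prime to \<open>p\<close>, so some
  coset is fixed, and fixing a coset means being conjugate into \<open>K\<close>.
\<close>
lemma p_subgroup_conjugate_into:
  assumes fin: "finite (carrier G)" and p: "prime p"
    and H: "subgroup H G" "card H = p ^ k" and K: "subgroup K G" "\<not> p dvd card (rcosets K)"
  obtains x where "x \<in> carrier G" "\<And>h. h \<in> H \<Longrightarrow> x \<otimes> h \<otimes> inv x \<in> K"
proof -
  let ?\<phi> = "\<lambda>g. \<lambda>C\<in>rcosets K. C #> inv g"
  interpret act: group_action "G\<lparr>carrier := H\<rparr>" "rcosets K" ?\<phi>
    using group_action.induced_action[OF coset_action[OF K(1)] H(1)] .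
  have finr: "finite (rcosets K)"
    using finite_subset[OF rcosets_subset_PowG[OF K(1)]] fin by simp
  have "card (rcosets K) mod p = card {C \<in> rcosets K. \<forall>g\<in>carrier (G\<lparr>carrier := H\<rparr>). ?\<phi> g C = C} mod p"
    using act.fixed_points_mod_prime[OF finr p, of k] H(2) by (simp add: order_def)
  then have "card {C \<in> rcosets K. \<forall>g\<in>carrier (G\<lparr>carrier := H\<rparr>). ?\<phi> g C = C} \<noteq> 0"
    using K(2) by (metis dvd_eq_mod_eq_0 mod_0)
  then have "{C \<in> rcosets K. \<forall>g\<in>carrier (G\<lparr>carrier := H\<rparr>). ?\<phi> g C = C} \<noteq> {}"
    by (metis card.empty)
  then obtain C where C: "C \<in> rcosets K" and fixed: "\<forall>g\<in>H. ?\<phi> g C = C" by fastforce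
  obtain x where x: "x \<in> carrier G" "C = K #> x" using C unfolding RCOSETS_def by blast
  have "x \<otimes> h \<otimes> inv x \<in> K" if h: "h \<in> H" for h
  proof -
    have "C #> inv h = C" using fixed h C by simp
    moreover have "h \<in> carrier G" using h subgroup.mem_carrier[OF H(1)] by blast
    ultimately show ?thesis using coset_stabilizer_iff[OF K(1) x(1)] x(2) by blast
  qed
  then show ?thesis using that x(1) by blast
qed

text \<open>
  \<open>H\<close> acts on its own cosets, and the cosets that it fixes are those inside its normaliser. This
  congruence yields both the growth of normalisers of \<open>p\<close>-subgroups and the congruence in Sylow's
  theorem.
\<close>
lemma normalizer_index_mod_prime:
  assumes fin: "finite (carrier G)" and p: "prime p"
    and H: "subgroup H G" "card H = p ^ k"
  shows "(order G div card H) mod p = (card (normalizer G H) div card H) mod p"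
proof -
  let ?\<phi> = "\<lambda>g. \<lambda>C\<in>rcosets H. C #> inv g"
  let ?N = "normalizer G H"
  have HG: "H \<subseteq> carrier G" using subgroup.subset[OF H(1)] .
  have finH: "finite H" using finite_subset[OF HG fin] .
  have pos: "0 < card H" using H(2) prime_gt_0_nat[OF p] by simp
  interpret act: group_action "G\<lparr>carrier := H\<rparr>" "rcosets H" ?\<phi>
    using group_action.induced_action[OF coset_action[OF H(1)] H(1)] .
  interpret N: group "G\<lparr>carrier := ?N\<rparr>"
    using subgroup_imp_group[OF subgroup_normalizer[OF H(1)]] .
  have finr: "finite (rcosets H)"
    using finite_subset[OF rcosets_subset_PowG[OF H(1)]] fin by simp
  have NG: "?N \<subseteq> carrier G" using subgroup.subset[OF subgroup_normalizer[OF H(1)]] .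
  have "{C \<in> rcosets H. \<forall>g\<in>H. ?\<phi> g C = C} = (\<lambda>x. H #> x) ` ?N"
  proof (intro equalityI subsetI)
    fix C assume "C \<in> {C \<in> rcosets H. \<forall>g\<in>H. ?\<phi> g C = C}"
    then have C: "C \<in> rcosets H" and fixed: "\<forall>g\<in>H. ?\<phi> g C = C" by blast+
    obtain x where x: "x \<in> carrier G" "C = H #> x" using C unfolding RCOSETS_def by blast
    have "x \<otimes> h \<otimes> inv x \<in> H" if h: "h \<in> H" for h
    proof -
      have "C #> inv h = C" using fixed h C by simp
      then show ?thesis using coset_stabilizer_iff[OF H(1) x(1)] x(2) h HG by blast
    qed
    then have "x \<in> ?N" using normalizer_iff_finite[OF HG finH] x(1) by blast
    then show "C \<in> (\<lambda>x. H #> x) ` ?N" using x(2) by blast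
  next
    fix C assume "C \<in> (\<lambda>x. H #> x) ` ?N"
    then obtain x where x: "x \<in> ?N" "C = H #> x" by blast
    have xG: "x \<in> carrier G" using x(1) NG by blast
    have C: "C \<in> rcosets H" using rcosetsI[OF HG xG] x(2) by simp
    have "?\<phi> h C = C" if h: "h \<in> H" for h
    proof -
      have "x \<otimes> h \<otimes> inv x \<in> H" using x(1) h normalizer_iff_finite[OF HG finH] by blast
      then have "C #> inv h = C" using coset_stabilizer_iff[OF H(1) xG] x(2) h HG by blast
      then show ?thesis using C by simp
    qed
    then show "C \<in> {C \<in> rcosets H. \<forall>g\<in>H. ?\<phi> g C = C}" using C by blast
  qed
  also have "\<dots> = rcosets\<^bsub>G\<lparr>carrier := ?N\<rparr>\<^esub> H"
    unfolding RCOSETS_def r_coset_def by auto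
  finally have fixed: "{C \<in> rcosets H. \<forall>g\<in>H. ?\<phi> g C = C} = rcosets\<^bsub>G\<lparr>carrier := ?N\<rparr>\<^esub> H" .
  have "card (rcosets\<^bsub>G\<lparr>carrier := ?N\<rparr>\<^esub> H) * card H = card ?N"
    using N.lagrange[OF subgroup_incl[OF H(1) subgroup_normalizer[OF H(1)] subgroup_in_normalizer[OF H(1)]]]
    by (simp add: order_def)
  then have "card (rcosets\<^bsub>G\<lparr>carrier := ?N\<rparr>\<^esub> H) = card ?N div card H"
    using pos by (metis nonzero_mult_div_cancel_right less_numeral_extra(3))
  moreover have "card (rcosets H) = order G div card H"
    using lagrange[OF H(1)] pos by (metis nonzero_mult_div_cancel_right less_numeral_extra(3))
  moreover have "card (rcosets H) mod p = card {C \<in> rcosets H. \<forall>g\<in>H. ?\<phi> g C = C} mod p"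
    using act.fixed_points_mod_prime[OF finr p, of k] H(2) by (simp add: order_def)
  ultimately show ?thesis using fixed by simp
qed

lemma p_subgroup_normalizer_grows:
  assumes fin: "finite (carrier G)" and p: "prime p"
    and H: "subgroup H G" "card H = p ^ k" and dvd: "p ^ Suc k dvd order G"
  shows "p ^ Suc k dvd card (normalizer G H)"
proof -
  have pos: "0 < p ^ k" using prime_gt_0_nat[OF p] by simp
  have "p dvd order G div card H"
    using dvd H(2) pos by (simp add: dvd_div_iff_mult dvd_mult_right mult.commute)
  then have "p dvd card (normalizer G H) div card H"
    using normalizer_index_mod_prime[OF fin p H] by (simp add: dvd_eq_mod_eq_0)
  moreover have "card H dvd card (normalizer G H)"
    using card_subgroup_dvd_subgroup[OF H(1) subgroup_normalizer[OF H(1)] subgroup_in_normalizer[OF H(1)]] .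
  ultimately show ?thesis using H(2) pos
    by (simp add: dvd_div_iff_mult)
qed

lemma Sylow_conjugate:
  assumes fin: "finite (carrier G)" and p: "prime p" and ord: "order G = p ^ a * m" "\<not> p dvd m"
    and P: "subgroup P G" "card P = p ^ a" and Q: "subgroup Q G" "card Q = p ^ a"
  obtains x where "x \<in> carrier G" "x <# Q #> inv x = P"
proof -
  have PG: "P \<subseteq> carrier G" and QG: "Q \<subseteq> carrier G" using subgroup.subset P(1) Q(1) by auto
  have "card (rcosets P) * p ^ a = m * p ^ a" using lagrange[OF P(1)] P(2) ord(1) by (simp add: mult.commute)
  then have "card (rcosets P) = m" using prime_gt_0_nat[OF p] by simp
  then obtain x where x: "x \<in> carrier G" "\<And>h. h \<in> Q \<Longrightarrow> x \<otimes> h \<otimes> inv x \<in> P"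
    using p_subgroup_conjugate_into[OF fin p Q P(1)] ord(2) by blast
  have "x <# Q #> inv x \<subseteq> P" unfolding conjugate_eq[OF x(1) QG] using x(2) by blast
  moreover have "card (x <# Q #> inv x) = card P" using card_conjugate[OF x(1) QG] P(2) Q(2) by simp
  ultimately have "x <# Q #> inv x = P"
    using card_subset_eq finite_subset[OF PG fin] by blast
  then show ?thesis using that x(1) by blast
qed

text \<open>
  Inside the normaliser of \<open>P\<close> the subgroups \<open>P\<close> and \<open>Q\<close> are Sylow subgroups, hence conjugate, but
  \<open>P\<close> is normal there. Consequently distinct Sylow subgroups have distinct normalisers.
\<close>
lemma Sylow_eq_of_normalizer:
  assumes fin: "finite (carrier G)" and p: "prime p" and ord: "order G = p ^ a * m" "\<not> p dvd m"
    and P: "subgroup P G" "card P = p ^ a" and Q: "subgroup Q G" "card Q = p ^ a"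
    and sub: "Q \<subseteq> normalizer G P"
  shows "Q = P"
proof -
  let ?N = "normalizer G P"
  have N: "subgroup ?N G" using subgroup_normalizer[OF P(1)] .
  interpret N: group "G\<lparr>carrier := ?N\<rparr>" using subgroup_imp_group[OF N] .
  have PG: "P \<subseteq> carrier G" and QG: "Q \<subseteq> carrier G" using subgroup.subset P(1) Q(1) by auto
  have PN: "P \<subseteq> ?N" using subgroup_in_normalizer[OF P(1)] .
  have finN: "finite ?N" using finite_subset[OF subgroup.subset[OF N] fin] .
  have "p ^ a dvd card ?N" using card_subgroup_dvd_subgroup[OF P(1) N PN] P(2) by simp
  then obtain k where k: "card ?N = p ^ a * k" by (rule dvdE)
  have "p ^ a * k dvd p ^ a * m" using card_subgroup_dvd[OF N] k ord(1) by simp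
  then have "k dvd m" using prime_gt_0_nat[OF p] by simp
  then have "\<not> p dvd k" using ord(2) dvd_trans by blast
  then obtain x where x: "x \<in> ?N" "x <#\<^bsub>G\<lparr>carrier := ?N\<rparr>\<^esub> Q #>\<^bsub>G\<lparr>carrier := ?N\<rparr>\<^esub> inv\<^bsub>G\<lparr>carrier := ?N\<rparr>\<^esub> x = P"
    using N.Sylow_conjugate[of p a k P Q] finN p k P(2) Q(2)
      subgroup_incl[OF P(1) N PN] subgroup_incl[OF Q(1) N sub] by (auto simp: order_def)
  have xG: "x \<in> carrier G" using x(1) subgroup.subset[OF N] by blast
  have "x <# Q #> inv x = P"
    using x(2) m_inv_consistent[OF N x(1)] by simp
  moreover have "x <# P #> inv x = P" using x(1) normalizer_iff[OF PG] by blast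
  ultimately show ?thesis using subgroup_conjugation_is_inj[OF xG QG PG] by simp
qed

text \<open>
  The last part is what makes Sylow subgroups expensive when subgroups are counted: besides the \<open>n\<close>
  Sylow subgroups there are \<open>n\<close> normalisers, all of order \<open>order G div n\<close>.
\<close>
theorem Sylow_counts:
  assumes fin: "finite (carrier G)" and p: "prime p" and ord: "order G = p ^ a * m" "\<not> p dvd m"
  defines "n \<equiv> subgroup_count G (p ^ a)"
  shows "n mod p = 1"
    and "n dvd m"
    and "subgroup P G \<Longrightarrow> card P = p ^ a \<Longrightarrow> n * card (normalizer G P) = order G"
    and "n \<le> subgroup_count G (order G div n)"
proof -
  let ?S = "{P. subgroup P G \<and> card P = p ^ a}"
  have pos: "0 < p ^ a" using prime_gt_0_nat[OF p] by simp
  have nN: "n * card (normalizer G P) = order G" if P: "P \<in> ?S" for P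
  proof -
    have P': "subgroup P G" "card P = p ^ a" using P by auto
    have PG: "P \<subseteq> carrier G" using subgroup.subset P'(1) by auto
    have "?S \<subseteq> conjugates P"
    proof
      fix Q assume "Q \<in> ?S"
      then obtain x where "x \<in> carrier G" "x <# P #> inv x = Q"
        using Sylow_conjugate[OF fin p ord _ _ P'] by blast
      then show "Q \<in> conjugates P" unfolding conjugates_def by blast
    qed
    then have "conjugates P = ?S" using conjugates_subgroups[OF P'(1)] P'(2) by auto
    then show ?thesis using card_conjugates[OF P'(1)] by (simp add: n_def subgroup_count_def)
  qed
  then show "subgroup P G \<Longrightarrow> card P = p ^ a \<Longrightarrow> n * card (normalizer G P) = order G" by blast
  obtain P where P: "subgroup P G" "card P = p ^ a"
    using sylow_thm[OF p is_group ord(1) fin] by blast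
  have PN: "P \<subseteq> normalizer G P" using subgroup_in_normalizer[OF P(1)] .
  have "p ^ a dvd card (normalizer G P)"
    using card_subgroup_dvd_subgroup[OF P(1) subgroup_normalizer[OF P(1)] PN] P(2) by simp
  then obtain k where k: "card (normalizer G P) = p ^ a * k" by (rule dvdE)
  have "n * card (normalizer G P) = order G" using nN P by blast
  then have "p ^ a * (n * k) = p ^ a * m" using k ord(1) by (simp add: mult.left_commute)
  then have nk: "n * k = m" using mult_cancel1 pos by (metis less_numeral_extra(3))
  then show "n dvd m" by (metis dvd_triv_left)
  have "\<not> p dvd k" using nk ord(2) by (metis dvd_mult)
  have m0: "0 < m" using ord(2) by (cases m) auto
  have "m mod p = k mod p"
    using normalizer_index_mod_prime[OF fin p P] P(2) ord(1) k prime_gt_0_nat[OF p] by simp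
  then have "n * k mod p = 1 * k mod p" using nk by simp
  moreover have "0 < n" using nk m0 by (cases n) auto
  ultimately have "p dvd (n - 1) * k"
    by (metis diff_mult_distrib mod_eq_dvd_iff_nat mult_le_mono1 Suc_leI One_nat_def)
  then have "p dvd n - 1" using \<open>\<not> p dvd k\<close> prime_dvd_mult_iff[OF p] by blast
  then have "n mod p = 1 mod p" using \<open>0 < n\<close> by (metis One_nat_def Suc_leI mod_eq_dvd_iff_nat)
  then show "n mod p = 1" using prime_gt_1_nat[OF p] by simp
  have "inj_on (normalizer G) ?S"
  proof (rule inj_onI)
    fix P Q assume PQ: "P \<in> ?S" "Q \<in> ?S" "normalizer G P = normalizer G Q"
    then have "Q \<subseteq> normalizer G P" using subgroup_in_normalizer by simp
    then show "P = Q" using Sylow_eq_of_normalizer[OF fin p ord] PQ by blast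
  qed
  moreover have "normalizer G ` ?S \<subseteq> {H. subgroup H G \<and> card H = order G div n}"
  proof (clarsimp, intro conjI)
    fix P assume P: "subgroup P G" "card P = p ^ a"
    show "subgroup (normalizer G P) G" using subgroup_normalizer[OF P(1)] .
    have "n * card (normalizer G P) = order G" using nN P by blast
    then show "card (normalizer G P) = order G div n" using \<open>0 < n\<close>
      by (metis nonzero_mult_div_cancel_left less_numeral_extra(3))
  qed
  ultimately have "card ?S \<le> card {H. subgroup H G \<and> card H = order G div n}"
    by (rule card_inj_on_le) (rule finite_subgroups[OF fin])
  then show "n \<le> subgroup_count G (order G div n)" by (simp add: n_def subgroup_count_def)
qed

section \<open>Counting elements of prime order\<close>

text \<open>
  Two distinct subgroups of order \<open>p\<close> meet trivially, so the union counts the elements of order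
  \<open>p\<close>.
\<close>
lemma card_prime_order_elements:
  assumes fin: "finite (carrier G)" and p: "prime p"
  shows "card (\<Union>P\<in>{P. subgroup P G \<and> card P = p}. P - {\<one>}) = (p - 1) * subgroup_count G p"
proof -
  let ?S = "{P. subgroup P G \<and> card P = p}"
  have finP: "finite P" if "subgroup P G" for P using finite_subset[OF subgroup.subset[OF that] fin] .
  have disj: "(P - {\<one>}) \<inter> (Q - {\<one>}) = {}" if P: "P \<in> ?S" and Q: "Q \<in> ?S" and ne: "P \<noteq> Q" for P Q
  proof (rule ccontr)
    assume "(P - {\<one>}) \<inter> (Q - {\<one>}) \<noteq> {}"
    then obtain x where x: "x \<in> P \<inter> Q" "x \<noteq> \<one>" by blast
    have P': "subgroup P G" "card P = p" and Q': "subgroup Q G" "card Q = p" using P Q by auto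
    have I: "subgroup (P \<inter> Q) G" using subgroups_Inter_pair[OF P'(1) Q'(1)] .
    have "card (P \<inter> Q) dvd p" using card_subgroup_dvd_subgroup[OF I P'(1)] P'(2) by simp
    moreover have "card {x, \<one>} \<le> card (P \<inter> Q)"
      using x(1) subgroup.one_closed[OF I] finP[OF I] by (intro card_mono) auto
    then have "card (P \<inter> Q) \<noteq> 1" using x(2) by simp
    ultimately have "card (P \<inter> Q) = p" using p prime_nat_iff by blast
    then have "P \<inter> Q = P" "P \<inter> Q = Q"
      using card_subset_eq[OF finP[OF P'(1)], of "P \<inter> Q"] card_subset_eq[OF finP[OF Q'(1)], of "P \<inter> Q"] P'(2) Q'(2) by auto
    then show False using ne by blast
  qed
  have "card (\<Union>P\<in>?S. P - {\<one>}) = (\<Sum>P\<in>?S. card (P - {\<one>}))"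
    by (rule card_UN_disjoint) (use finite_subgroups[OF fin] finP disj in auto)
  also have "\<dots> = (\<Sum>P\<in>?S. p - 1)"
    by (rule sum.cong) (auto simp: card_Diff_singleton[OF subgroup.one_closed])
  also have "\<dots> = (p - 1) * subgroup_count G p" by (simp add: subgroup_count_def)
  finally show ?thesis .
qed

lemma prime_order_elements_disjoint:
  assumes p: "prime p" and P: "subgroup P G" "card P = p" and H: "subgroup H G" "\<not> p dvd card H"
    and fin: "finite (carrier G)"
  shows "(P - {\<one>}) \<inter> H = {}"
proof -
  have I: "subgroup (P \<inter> H) G" using subgroups_Inter_pair[OF P(1) H(1)] .
  have "card (P \<inter> H) dvd p" using card_subgroup_dvd_subgroup[OF I P(1)] P(2) by simp
  moreover have "card (P \<inter> H) \<noteq> p" using card_subgroup_dvd_subgroup[OF I H(1)] H(2) by auto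
  ultimately have "card (P \<inter> H) = 1" using p prime_nat_iff by blast
  then obtain z where "P \<inter> H = {z}" by (auto simp: card_1_singleton_iff)
  then have "P \<inter> H = {\<one>}" using subgroup.one_closed[OF I] by auto
  then show ?thesis by blast
qed

lemma element_count:
  assumes fin: "finite (carrier G)" and p: "prime p" and d: "\<not> p dvd d"
  shows "(p - 1) * subgroup_count G p + card (\<Union>{H. subgroup H G \<and> card H = d}) \<le> order G"
proof -
  let ?U = "\<Union>P\<in>{P. subgroup P G \<and> card P = p}. P - {\<one>}" and ?V = "\<Union>{H. subgroup H G \<and> card H = d}"
  have sub: "?U \<subseteq> carrier G" "?V \<subseteq> carrier G" using subgroup.subset by blast+
  have "?U \<inter> ?V = {}" using prime_order_elements_disjoint[OF p _ _ _ _ fin] d by blast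
  then have "card (?U \<union> ?V) = card ?U + card ?V"
    using card_Un_disjoint finite_subset[OF sub(1) fin] finite_subset[OF sub(2) fin] by blast
  moreover have "card (?U \<union> ?V) \<le> order G" unfolding order_def using sub fin by (intro card_mono) auto
  ultimately show ?thesis using card_prime_order_elements[OF fin p] by simp
qed

end

section \<open>Finite simple groups acting on cosets\<close>

text \<open>
  Actions are functions on the set that is acted on, whereas \<open>sym_group n\<close> consists of permutations
  of \<open>{1..n}\<close>. The bijection \<open>f\<close> transports the one to the other.
\<close>
lemma (in group_action) permutation_representation:
  assumes E: "finite E" and n: "n = card E"
  obtains f h where "bij_betw f {1..n} E" "h \<in> hom G (sym_group n)"
    "\<And>g i. g \<in> carrier G \<Longrightarrow> i \<in> {1..n} \<Longrightarrow> f (h g i) = \<phi> g (f i)"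
proof -
  have "card {1..n} = card E" using n by simp
  then obtain f where f: "bij_betw f {1..n} E" using finite_same_card_bij[OF _ E] by blast
  define h where "h g = (\<lambda>i. if i \<in> {1..n} then inv_into {1..n} f (\<phi> g (f i)) else i)" for g
  have fE: "f i \<in> E" if "i \<in> {1..n}" for i using f that by (meson bij_betwE)
  have phi: "bij_betw (\<phi> g) E E" if "g \<in> carrier G" for g using bij_prop0[OF that] by (simp add: Bij_def)
  have fh: "f (h g i) = \<phi> g (f i)" if "g \<in> carrier G" "i \<in> {1..n}" for g i
  proof -
    have "\<phi> g (f i) \<in> E" using phi[OF that(1)] fE[OF that(2)] by (meson bij_betwE)
    then show ?thesis using that(2) bij_betw_inv_into_right[OF f] by (simp add: h_def)
  qed
  have per: "h g permutes {1..n}" if g: "g \<in> carrier G" for g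
  proof (rule bij_imp_permutes)
    have "bij_betw (inv_into {1..n} f \<circ> (\<phi> g \<circ> f)) {1..n} {1..n}"
      using bij_betw_trans[OF bij_betw_trans[OF f phi[OF g]] bij_betw_inv_into[OF f]] .
    then show "bij_betw (h g) {1..n} {1..n}"
      by (rule bij_betw_cong[THEN iffD1, rotated]) (simp add: h_def)
    show "h g i = i" if "i \<notin> {1..n}" for i using that unfolding h_def by argo
  qed
  have mult: "h (g1 \<otimes> g2) = h g1 \<circ> h g2" if g: "g1 \<in> carrier G" "g2 \<in> carrier G" for g1 g2
  proof
    fix i
    interpret group G using group_hom group_hom.axioms(1) by blast
    show "h (g1 \<otimes> g2) i = (h g1 \<circ> h g2) i"
    proof (cases "i \<in> {1..n}")
      case True
      have i2: "h g2 i \<in> {1..n}" using permutes_in_image[OF per[OF g(2)]] True by simp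
      have "f (h (g1 \<otimes> g2) i) = \<phi> g1 (\<phi> g2 (f i))"
        using fh[of "g1 \<otimes> g2" i] True g composition_rule[OF fE[OF True] g] by simp
      also have "\<dots> = f (h g1 (h g2 i))" using fh[OF g(1) i2] fh[OF g(2) True] by simp
      finally have eq: "f (h (g1 \<otimes> g2) i) = f (h g1 (h g2 i))" .
      have "h (g1 \<otimes> g2) i \<in> {1..n}" "h g1 (h g2 i) \<in> {1..n}"
        using permutes_in_image[OF per[of "g1 \<otimes> g2"]] permutes_in_image[OF per[OF g(1)]] True i2 g by simp_all
      then show ?thesis
        unfolding comp_apply by (intro inj_onD[OF bij_betw_imp_inj_on[OF f] eq])
    next
      case False
      then have "h g i = i" for g unfolding h_def by argo
      then show ?thesis by simp
    qed
  qed
  have "h \<in> hom G (sym_group n)"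
    unfolding hom_def using per mult by (simp add: sym_group_def)
  then show ?thesis using that[OF f _ fh] by blast
qed

lemma (in simple_group) hom_inj_or_trivial:
  assumes "group_hom G H h"
  shows "inj_on h (carrier G) \<or> (\<forall>x\<in>carrier G. h x = \<one>\<^bsub>H\<^esub>)"
proof -
  interpret h: group_hom G H h using assms .
  have "kernel G H h = carrier G \<or> kernel G H h = {\<one>}"
    using no_real_normal_subgroup[OF h.normal_kernel] .
  then show ?thesis
  proof
    assume "kernel G H h = carrier G"
    then show ?thesis unfolding kernel_def by blast
  next
    assume "kernel G H h = {\<one>}"
    then show ?thesis using h.inj_iff_trivial_ker by blast
  qed
qed

text \<open>
  An element all of whose conjugates lie in \<open>K\<close> acts trivially on the cosets of \<open>K\<close>, and a simple
  group acts faithfully on the cosets of a proper subgroup.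
\<close>
lemma (in simple_group) core_trivial:
  assumes K: "subgroup K G" "K \<noteq> carrier G" and y: "y \<in> carrier G"
    and conj: "\<And>x. x \<in> carrier G \<Longrightarrow> x \<otimes> y \<otimes> inv x \<in> K"
  shows "y = \<one>"
proof -
  let ?\<phi> = "\<lambda>g. \<lambda>C\<in>rcosets K. C #> inv g"
  interpret act: group_action G "rcosets K" ?\<phi> using coset_action[OF K(1)] .
  interpret hom: group_hom G "BijGroup (rcosets K)" ?\<phi> using act.group_hom .
  have fix_all: "?\<phi> y = \<one>\<^bsub>BijGroup (rcosets K)\<^esub>"
  proof -
    have "C #> inv y = C" if C: "C \<in> rcosets K" for C
    proof -
      obtain x where x: "x \<in> carrier G" "C = K #> x" using C unfolding RCOSETS_def by blast
      then show ?thesis using coset_stabilizer_iff[OF K(1) x(1) y] conj by blast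
    qed
    then have "?\<phi> y = (\<lambda>C\<in>rcosets K. C)" by (intro restrict_ext) 
    then show ?thesis unfolding BijGroup_def by simp
  qed
  have "\<not> (\<forall>x\<in>carrier G. ?\<phi> x = \<one>\<^bsub>BijGroup (rcosets K)\<^esub>)"
  proof
    assume triv: "\<forall>x\<in>carrier G. ?\<phi> x = \<one>\<^bsub>BijGroup (rcosets K)\<^esub>"
    obtain x where x: "x \<in> carrier G" "x \<notin> K" using K subgroup.subset[OF K(1)] by blast
    have KR: "K #> \<one> \<in> rcosets K" using rcosetsI[OF subgroup.subset[OF K(1)] one_closed] .
    have "?\<phi> x (K #> \<one>) = (\<lambda>C\<in>rcosets K. C) (K #> \<one>)"
      using triv x(1) by (simp add: BijGroup_def)
    then have "K #> \<one> #> inv x = K #> \<one>" using KR by simp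
    then have "\<one> \<otimes> x \<otimes> inv \<one> \<in> K" using coset_stabilizer_iff[OF K(1) one_closed x(1)] by blast
    then show False using x by simp
  qed
  then have "inj_on ?\<phi> (carrier G)" using hom_inj_or_trivial[OF hom.group_hom_axioms] by blast
  then show ?thesis using fix_all hom.hom_one y one_closed by (metis inj_onD)
qed

locale finite_nonabelian_simple_group = simple_group +
  assumes fin: "finite (carrier G)" and nonabelian: "\<not> comm_group G"
begin

text \<open>
  The centre is the set of fixed points of the conjugation action, so in a \<open>p\<close>-group its size is
  divisible by \<open>p\<close>. A nontrivial centre of a simple group is the whole group.
\<close>
lemma order_not_prime_power:
  assumes p: "prime p" shows "order G \<noteq> p ^ k"
proof
  assume ord: "order G = p ^ k"
  let ?\<phi> = "\<lambda>g. \<lambda>h\<in>carrier G. g \<otimes> h \<otimes> inv g"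
  let ?Z = "{x \<in> carrier G. \<forall>g\<in>carrier G. ?\<phi> g x = x}"
  interpret act: group_action G "carrier G" ?\<phi> using action_by_conjugation .
  have Z_iff: "x \<in> ?Z \<longleftrightarrow> x \<in> carrier G \<and> (\<forall>g\<in>carrier G. g \<otimes> x = x \<otimes> g)" for x
  proof -
    have "g \<otimes> x \<otimes> inv g = x \<longleftrightarrow> g \<otimes> x = x \<otimes> g" if "g \<in> carrier G" "x \<in> carrier G" for g
      using that by (metis inv_solve_right m_closed)
    then show ?thesis by auto
  qed
  have k: "k \<noteq> 0" using ord order_gt_one by (cases k) auto
  have "card ?Z mod p = card (carrier G) mod p" using act.fixed_points_mod_prime[OF fin p ord] by (rule sym)
  also have "\<dots> = p ^ k mod p" using ord by (simp only: order_def)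
  also have "\<dots> = 0" using k by (simp add: dvd_imp_mod_0 dvd_power)
  finally have "card ?Z mod p = 0" .
  then have Z1: "card ?Z \<noteq> 1" using prime_gt_1_nat[OF p] by (metis mod_less zero_neq_one)
  have sub: "subgroup ?Z G"
  proof (rule subgroupI)
    show "?Z \<noteq> {}" using Z_iff[of \<one>] by force
    show "inv a \<in> ?Z" if "a \<in> ?Z" for a
    proof -
      have a: "a \<in> carrier G" "\<And>g. g \<in> carrier G \<Longrightarrow> g \<otimes> a = a \<otimes> g" using that Z_iff by blast+
      have "g \<otimes> inv a = inv a \<otimes> g" if g: "g \<in> carrier G" for g
        using a(2)[of "inv g"] g a(1) by (metis inv_closed inv_inv inv_mult_group)
      then show ?thesis using Z_iff a(1) by blast
    qed
    show "a \<otimes> b \<in> ?Z" if "a \<in> ?Z" "b \<in> ?Z" for a b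
    proof -
      have a: "a \<in> carrier G" "\<And>g. g \<in> carrier G \<Longrightarrow> g \<otimes> a = a \<otimes> g"
        and b: "b \<in> carrier G" "\<And>g. g \<in> carrier G \<Longrightarrow> g \<otimes> b = b \<otimes> g" using that Z_iff by blast+
      have "g \<otimes> (a \<otimes> b) = a \<otimes> b \<otimes> g" if g: "g \<in> carrier G" for g
        using a b g by (metis m_assoc)
      then show ?thesis using Z_iff a(1) b(1) by blast
    qed
  qed blast
  have "?Z \<lhd> G"
  proof (rule normal_invI[OF sub])
    fix x h assume "x \<in> carrier G" "h \<in> ?Z"
    then have "?\<phi> x h = h" "h \<in> carrier G" by blast+
    then have "x \<otimes> h \<otimes> inv x = h" by simp
    then show "x \<otimes> h \<otimes> inv x \<in> ?Z" using \<open>h \<in> ?Z\<close> by argo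
  qed
  then have "?Z = carrier G \<or> ?Z = {\<one>}" by (rule no_real_normal_subgroup)
  moreover have "?Z \<noteq> {\<one>}" using Z1 by (metis is_singletonI is_singleton_altdef)
  ultimately have "?Z = carrier G" by blast
  then have "comm_group G" using Z_iff by (intro group_comm_groupI) blast
  then show False using nonabelian by blast
qed

lemma order_gt_two: "2 < order G"
  using order_not_prime_power[of 2 1] order_gt_one by simp

text \<open>
  The action on the cosets of \<open>K\<close> is faithful. Composed with the sign it becomes a homomorphism to a
  group of order two, which cannot be injective and is therefore trivial.
\<close>
lemma embedding_into_alt_group:
  assumes K: "subgroup K G" "K \<noteq> carrier G" and n: "n * card K = order G"
  obtains h where "h \<in> hom G (alt_group n)" "inj_on h (carrier G)"
proof -
  let ?\<phi> = "\<lambda>g. \<lambda>C\<in>rcosets K. C #> inv g"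
  interpret act: group_action G "rcosets K" ?\<phi> using coset_action[OF K(1)] .
  have finr: "finite (rcosets K)"
    using finite_subset[OF rcosets_subset_PowG[OF K(1)]] fin by simp
  have "0 < card K" using subgroup.finite_imp_card_positive[OF K(1) fin] .
  moreover have "card (rcosets K) * card K = n * card K" using lagrange[OF K(1)] n by simp
  ultimately have n': "n = card (rcosets K)" by simp
  obtain h f where f: "bij_betw f {1..n} (rcosets K)" and h: "h \<in> hom G (sym_group n)"
    and fh: "\<And>g i. g \<in> carrier G \<Longrightarrow> i \<in> {1..n} \<Longrightarrow> f (h g i) = ?\<phi> g (f i)"
    by (rule act.permutation_representation[OF finr n']) (rule that)
  have ghom: "group_hom G (sym_group n) h"
    using h sym_group_is_group is_group by (intro group_hom.intro group_hom_axioms.intro)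
  interpret h: group_hom G "sym_group n" h using ghom .
  have inj: "inj_on h (carrier G)"
  proof -
    have "y = \<one>" if y: "y \<in> carrier G" "h y = id" for y
    proof (rule core_trivial[OF K y(1)])
      fix x assume x: "x \<in> carrier G"
      have C: "K #> x \<in> rcosets K" using rcosetsI[OF subgroup.subset[OF K(1)] x] .
      then obtain i where i: "i \<in> {1..n}" "f i = K #> x" using f by (metis bij_betw_def imageE)
      have "?\<phi> y (K #> x) = K #> x" using fh[OF y(1) i(1)] y(2) i(2) by simp
      then have "K #> x #> inv y = K #> x" using C by simp
      then show "x \<otimes> y \<otimes> inv x \<in> K" using coset_stabilizer_iff[OF K(1) x y(1)] by blast
    qed
    then have "kernel G (sym_group n) h = {\<one>}"
      using h.hom_one unfolding kernel_def by (auto simp: sym_group_def)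
    then show ?thesis using h.inj_iff_trivial_ker by blast
  qed
  have "sign \<circ> h \<in> hom G sign_img"
    using Group.hom_compose[OF h sign_is_hom] .
  then have sgn: "group_hom G sign_img (sign \<circ> h)"
    using sign_img_is_group is_group by (intro group_hom.intro group_hom_axioms.intro)
  have "\<not> inj_on (sign \<circ> h) (carrier G)"
  proof
    assume "inj_on (sign \<circ> h) (carrier G)"
    moreover have "(sign \<circ> h) ` carrier G \<subseteq> {-1, 1}"
      using group_hom.hom_closed[OF sgn] by (auto simp: sign_img_def)
    ultimately have "card (carrier G) \<le> card {-1, 1::int}" by (rule card_inj_on_le) simp
    then show False using order_gt_two by (simp add: order_def)
  qed
  then have "\<forall>x\<in>carrier G. (sign \<circ> h) x = \<one>\<^bsub>sign_img\<^esub>" using hom_inj_or_trivial[OF sgn] by blast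
  then have even: "evenperm (h x)" if "x \<in> carrier G" for x
    using that by (simp add: sign_img_def sign_def split: if_splits)
  have "h \<in> hom G (alt_group n)"
    using h even unfolding hom_def by (auto simp: alt_group_def sym_group_def)
  then show ?thesis using that inj by blast
qed

text \<open>
  This is the main source of lower bounds on indices, hence on the sizes of conjugacy classes of
  subgroups. The factor 2, which comes from the alternating group, decides several cases later.
\<close>
lemma order_dvd_fact_index:
  assumes K: "subgroup K G" "K \<noteq> carrier G" and n: "n * card K = order G"
  shows "2 * order G dvd fact n"
proof -
  obtain h where h: "h \<in> hom G (alt_group n)" "inj_on h (carrier G)"
    using embedding_into_alt_group[OF assms] .
  interpret A: group "alt_group n" by (rule alt_group_is_group)
  have "group_hom G (alt_group n) h"
    using h(1) is_group alt_group_is_group by (intro group_hom.intro group_hom_axioms.intro)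
  then have sub: "subgroup (h ` carrier G) (alt_group n)"
    using group_hom.img_is_subgroup by blast
  have "card (h ` carrier G) dvd order (alt_group n)" using A.card_subgroup_dvd[OF sub] .
  moreover have "card (h ` carrier G) = order G" using card_image[OF h(2)] by (simp add: order_def)
  ultimately have dvd: "order G dvd card (carrier (alt_group n))" by (simp add: order_def)
  have "n \<noteq> 0" using n order_gt_one by (cases n) auto
  moreover have "n \<noteq> 1"
  proof
    assume "n = 1"
    then have "card K = card (carrier G)" using n by (simp add: order_def)
    then show False using K(2) card_subset_eq[OF fin subgroup.subset[OF K(1)]] by blast
  qed
  ultimately have "2 * card (carrier (alt_group n)) = fact n" by (intro alt_group_card_carrier) simp
  then show ?thesis using mult_dvd_mono[OF dvd_refl[of 2] dvd] by argo
qed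

text \<open>
  Otherwise all conjugates of an element of \<open>P\<close> would lie in \<open>K\<close>.
\<close>
lemma subgroups_of_order_not_all_inside:
  assumes K: "subgroup K G" "K \<noteq> carrier G" and d: "1 < d" and P: "subgroup P G" "card P = d"
  shows "\<exists>Q. subgroup Q G \<and> card Q = d \<and> \<not> Q \<subseteq> K"
proof (rule ccontr)
  assume "\<nexists>Q. subgroup Q G \<and> card Q = d \<and> \<not> Q \<subseteq> K"
  then have all: "Q \<subseteq> K" if "subgroup Q G" "card Q = d" for Q using that by blast
  have PG: "P \<subseteq> carrier G" using subgroup.subset[OF P(1)] .
  have "y = \<one>" if y: "y \<in> P" for y
  proof (rule core_trivial[OF K])
    show "y \<in> carrier G" using y PG by blast
    fix x assume x: "x \<in> carrier G"
    have "x <# P #> inv x \<subseteq> K"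
      using all subgroup_conjugation_is_surj2[OF x P(1)] card_conjugate[OF x PG] P(2) by simp
    then show "x \<otimes> y \<otimes> inv x \<in> K" unfolding conjugate_eq[OF x PG] using y by blast
  qed
  then have "P \<subseteq> {\<one>}" by blast
  then have "card P \<le> 1" by (metis card.empty card_insert_disjoint card_mono finite.emptyI finite.insertI equals0D One_nat_def)
  then show False using d P(2) by simp
qed

text \<open>
  Suppose that a Sylow \<open>p\<close>-subgroup of the proper subgroup \<open>K\<close> is Sylow in \<open>G\<close> as well. Either it
  is normal in \<open>K\<close>, and then \<open>K\<close> lies in its normaliser, whose order is \<open>order G div n\<close>; or \<open>K\<close>
  has \<open>c > 1\<close> Sylow \<open>p\<close>-subgroups, which by simplicity are not all those of \<open>G\<close>.
\<close>
lemma Sylow_in_proper_subgroup: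
  assumes K: "subgroup K G" "K \<noteq> carrier G" and p: "prime p" and a: "0 < a"
    and cK: "card K = p ^ a * k" "\<not> p dvd k" and cG: "order G = p ^ a * m" "\<not> p dvd m"
  defines "n \<equiv> subgroup_count G (p ^ a)"
  shows "n * card K dvd order G \<or> (\<exists>c>1. c mod p = 1 \<and> c dvd k \<and> c < n)"
proof -
  interpret K: group "G\<lparr>carrier := K\<rparr>" using subgroup_imp_group[OF K(1)] .
  let ?c = "subgroup_count (G\<lparr>carrier := K\<rparr>) (p ^ a)"
  have finK: "finite K" using finite_subset[OF subgroup.subset[OF K(1)] fin] .
  have fK: "finite (carrier (G\<lparr>carrier := K\<rparr>))" using finK by simp
  have oK: "order (G\<lparr>carrier := K\<rparr>) = p ^ a * k" using cK(1) by (simp add: order_def)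
  have c: "?c mod p = 1" "?c dvd k" using K.Sylow_counts(1,2)[OF fK p oK cK(2)] .
  have pa: "1 < p ^ a" using prime_gt_1_nat[OF p] a by (metis one_less_power)
  obtain P where P: "subgroup P (G\<lparr>carrier := K\<rparr>)" "card P = p ^ a"
    using sylow_thm[OF p K.is_group oK fK] by blast
  have PG: "subgroup P G" using incl_subgroup[OF K(1) P(1)] .
  have PK: "P \<subseteq> K" using subgroup.subset[OF P(1)] by simp
  show ?thesis
  proof (cases "?c = 1")
    case True
    have "?c * card (normalizer (G\<lparr>carrier := K\<rparr>) P) = order (G\<lparr>carrier := K\<rparr>)"
      using K.Sylow_counts(3)[OF fK p oK cK(2) P] .
    then have "card (normalizer (G\<lparr>carrier := K\<rparr>) P) = card K" using True by (simp add: order_def)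
    moreover have "normalizer (G\<lparr>carrier := K\<rparr>) P \<subseteq> K"
      using subgroup.subset[OF K.subgroup_normalizer[OF P(1)]] by simp
    ultimately have NK: "normalizer (G\<lparr>carrier := K\<rparr>) P = K" using card_subset_eq[OF finK] by blast
    have "K \<subseteq> normalizer G P"
    proof
      fix x assume x: "x \<in> K"
      then have "x \<in> normalizer (G\<lparr>carrier := K\<rparr>) P" using NK by simp
      then have "x <#\<^bsub>G\<lparr>carrier := K\<rparr>\<^esub> P #>\<^bsub>G\<lparr>carrier := K\<rparr>\<^esub> inv\<^bsub>G\<lparr>carrier := K\<rparr>\<^esub> x = P"
        using K.normalizer_iff[of P x] PK by simp
      then have "x <# P #> inv x = P" using m_inv_consistent[OF K(1) x] by simp
      then show "x \<in> normalizer G P"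
        using normalizer_iff[OF subgroup.subset[OF PG], of x] x subgroup.subset[OF K(1)] by blast
    qed
    then have "card K dvd card (normalizer G P)"
      using card_subgroup_dvd_subgroup[OF K(1) subgroup_normalizer[OF PG]] by blast
    then have "n * card K dvd n * card (normalizer G P)" by (rule mult_dvd_mono[OF dvd_refl])
    then show ?thesis using Sylow_counts(3)[OF fin p cG PG P(2)] by (simp add: n_def)
  next
    case False
    have "?c \<noteq> 0" using c(1) by (metis mod_0 zero_neq_one)
    then have "1 < ?c" using False by simp
    moreover have "?c < n"
    proof -
      have fS: "finite {Q. subgroup Q G \<and> card Q = p ^ a}" using finite_subgroups[OF fin] .
      have "{Q. subgroup Q (G\<lparr>carrier := K\<rparr>) \<and> card Q = p ^ a} \<subseteq> {Q. subgroup Q G \<and> card Q = p ^ a}"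
        using incl_subgroup[OF K(1)] by blast
      moreover obtain Q where Q: "subgroup Q G" "card Q = p ^ a" "\<not> Q \<subseteq> K"
        using subgroups_of_order_not_all_inside[OF K pa PG P(2)] by blast
      have "Q \<notin> {Q. subgroup Q (G\<lparr>carrier := K\<rparr>) \<and> card Q = p ^ a}"
        using Q(3) subgroup.subset[of Q "G\<lparr>carrier := K\<rparr>"] by auto
      ultimately have "{Q. subgroup Q (G\<lparr>carrier := K\<rparr>) \<and> card Q = p ^ a} \<subset> {Q. subgroup Q G \<and> card Q = p ^ a}"
        using Q by blast
      then show ?thesis unfolding n_def subgroup_count_def using psubset_card_mono[OF fS] by blast
    qed
    ultimately show ?thesis using c by blast
  qed
qed

lemma conjugacy_class_of_subgroup:
  assumes H: "subgroup H G" "H \<noteq> carrier G" "H \<noteq> {\<one>}"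
  shows "card (conjugates H) \<le> subgroup_count G (card H)"
    and "2 * order G dvd fact (card (conjugates H))"
    and "0 < subgroup_count G (order G div card (conjugates H))"
proof -
  let ?N = "normalizer G H" and ?c = "card (conjugates H)"
  have cN: "?c * card ?N = order G" using card_conjugates[OF H(1)] .
  have "?N \<noteq> carrier G"
    using no_real_normal_subgroup[OF normal_if_normalizer_full[OF H(1)]] H(2,3) by blast
  then show "2 * order G dvd fact ?c"
    using order_dvd_fact_index[OF subgroup_normalizer[OF H(1)] _ cN] by blast
  show "?c \<le> subgroup_count G (card H)"
    unfolding subgroup_count_def using conjugates_subgroups[OF H(1)]
    by (intro card_mono finite_subgroups[OF fin])
  have "?c \<noteq> 0" using cN order_gt_one by (metis mult_0 less_nat_zero_code)
  then have "order G div ?c = card ?N" using cN by (metis nonzero_mult_div_cancel_left)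
  then show "0 < subgroup_count G (order G div ?c)"
    using subgroup_count_pos[OF fin subgroup_normalizer[OF H(1)]] by simp
qed

text \<open>
  The number \<open>c\<close> is the size of a conjugacy class of subgroups of order \<open>d\<close>, and the subgroup of
  order \<open>order G div c\<close> is a normaliser.
\<close>
lemma conjugacy_class_of_order:
  assumes "0 < subgroup_count G d" "1 < d" "d < order G"
  shows "\<exists>c\<le>subgroup_count G d. 2 * order G dvd fact c \<and> 0 < subgroup_count G (order G div c)"
proof -
  obtain H where H: "subgroup H G" "card H = d" using subgroup_count_posD[OF assms(1)] .
  have "H \<noteq> carrier G" using H(2) assms(3) by (auto simp: order_def)
  moreover have "H \<noteq> {\<one>}" using H(2) assms(2) by auto
  ultimately show ?thesis using conjugacy_class_of_subgroup[OF H(1)] H(2) by blast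
qed

lemma p_subgroup_proper:
  assumes "prime p" "0 < k" "subgroup H G" "card H = p ^ k"
  shows "H \<noteq> carrier G" "H \<noteq> {\<one>}"
proof -
  show "H \<noteq> carrier G" using order_not_prime_power[OF assms(1), of k] assms(4) by (auto simp: order_def)
  have "1 < p ^ k" using prime_gt_1_nat[OF assms(1)] assms(2) by (metis one_less_power)
  then show "H \<noteq> {\<one>}" using assms(4) by auto
qed

text \<open>
  A sharper form for a \<open>p\<close>-subgroup that is not Sylow: its normaliser is divisible by a further
  factor \<open>p\<close>.
\<close>
lemma conjugacy_class_of_p_subgroup:
  assumes p: "prime p" and k: "0 < k" and dvd: "p ^ Suc k dvd order G"
  shows "\<exists>c\<le>subgroup_count G (p ^ k). c * p ^ Suc k dvd order G \<and> 2 * order G dvd fact c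
    \<and> 0 < subgroup_count G (order G div c)"
proof -
  have "p ^ k dvd order G" using dvd by (simp add: dvd_mult_right mult.commute)
  then obtain m where "order G = p ^ k * m" by (rule dvdE)
  then obtain H where H: "subgroup H G" "card H = p ^ k" using sylow_thm[OF p is_group _ fin] by blast
  have "card (conjugates H) * p ^ Suc k dvd card (conjugates H) * card (normalizer G H)"
    using p_subgroup_normalizer_grows[OF fin p H dvd] by (rule mult_dvd_mono[OF dvd_refl])
  then have "card (conjugates H) * p ^ Suc k dvd order G" unfolding card_conjugates[OF H(1)] .
  then show ?thesis
    using conjugacy_class_of_subgroup[OF H(1) p_subgroup_proper[OF p k H]] H(2) by metis
qed

text \<open>
  The Sylow subgroups form one conjugacy class, so their number is the index of a proper subgroup.
\<close>
lemma order_dvd_fact_Sylow_count: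
  assumes p: "prime p" and ord: "order G = p ^ a * m" "\<not> p dvd m" and a: "0 < a"
  shows "2 * order G dvd fact (subgroup_count G (p ^ a))"
proof -
  obtain P where P: "subgroup P G" "card P = p ^ a" using sylow_thm[OF p is_group ord(1) fin] by blast
  have "subgroup_count G (p ^ a) * card (normalizer G P) = card (conjugates P) * card (normalizer G P)"
    using Sylow_counts(3)[OF fin p ord P] card_conjugates[OF P(1)] by simp
  moreover have "0 < card (normalizer G P)"
    using subgroup.finite_imp_card_positive[OF subgroup_normalizer[OF P(1)] fin] .
  ultimately have "subgroup_count G (p ^ a) = card (conjugates P)" by simp
  then show ?thesis using conjugacy_class_of_subgroup(2)[OF P(1) p_subgroup_proper[OF p a P]] by simp
qed

end

section \<open>Simple sections of nonsolvable groups\<close>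

text \<open>
  Take \<open>H\<close> minimal among the nonsolvable subgroups and \<open>N\<close> maximal among its proper normal
  subgroups. Then \<open>N\<close> is solvable, the quotient is simple by the correspondence of normal subgroups,
  and an abelian quotient would make \<open>H\<close> solvable.
\<close>
lemma (in group) nonsolvable_simple_section:
  assumes fin: "finite (carrier G)" and ns: "\<not> solvable G"
  obtains H N where "subgroup H G" "N \<lhd> G\<lparr>carrier := H\<rparr>"
    "finite_nonabelian_simple_group (G\<lparr>carrier := H\<rparr> Mod N)"
proof -
  have "subgroup (carrier G) G \<and> \<not> solvable_seq G (carrier G)"
    using ns subgroup_self unfolding solvable_def by blast
  then obtain H where H: "subgroup H G" "\<not> solvable_seq G H"
    and minH: "\<And>K. subgroup K G \<and> \<not> solvable_seq G K \<Longrightarrow> card H \<le> card K"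
    using ex_has_least_nat[of "\<lambda>H. subgroup H G \<and> \<not> solvable_seq G H" "carrier G" card] by blast
  let ?M = "G\<lparr>carrier := H\<rparr>"
  interpret M: group ?M using subgroup_imp_group[OF H(1)] .
  have finH: "finite H" using finite_subset[OF subgroup.subset[OF H(1)] fin] .
  have "H \<noteq> {\<one>}" using H(2) solvable_seq.unity[of G] by metis
  then have one: "{\<one>} \<lhd> ?M \<and> {\<one>} \<noteq> H" using M.one_is_normal by simp
  have bound: "card N < Suc (card H)" if "N \<lhd> ?M \<and> N \<noteq> H" for N
    using card_mono[OF finH, of N] subgroup.subset[OF normal_imp_subgroup, of N ?M] that by simp
  obtain N where N: "N \<lhd> ?M" "N \<noteq> H"
    and maxN: "\<And>A. A \<lhd> ?M \<and> A \<noteq> H \<Longrightarrow> card A \<le> card N"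
    using ex_has_greatest_nat[of "\<lambda>N. N \<lhd> ?M \<and> N \<noteq> H", OF one, of card "Suc (card H)"] bound by blast
  interpret N: normal N ?M using N(1) .
  have NH: "N \<subseteq> H" using N.subset by simp
  have subN: "subgroup N G" using incl_subgroup[OF H(1) N.subgroup_axioms] .
  have "card N < card H" using psubset_card_mono[OF finH] NH N(2) by blast
  then have solvN: "solvable_seq G N" using minH[of N] subN by (meson not_le)
  interpret S: group "?M Mod N" using N.factorgroup_is_group .
  have finS: "finite (carrier (?M Mod N))"
    using finite_subset[OF M.rcosets_subset_PowG[OF N.subgroup_axioms]] finH by (simp add: FactGroup_def)
  have nab: "\<not> comm_group (?M Mod N)"
    using solvable_seq.extension[OF solvN N(1) H(1)] H(2) by blast
  have simp: "A = carrier (?M Mod N) \<or> A = {\<one>\<^bsub>?M Mod N\<^esub>}" if A: "A \<lhd> ?M Mod N" for A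
  proof -
    have subA: "subgroup A (?M Mod N)" using normal_imp_subgroup[OF A] .
    have carS: "carrier (?M Mod N) = (\<lambda>x. N #>\<^bsub>?M\<^esub> x) ` H" using carrier_FactGroup[of ?M N] by simp
    have char: "\<Union>A = {x \<in> H. N #>\<^bsub>?M\<^esub> x \<in> A}" using N.factgroup_subgroup_union_char[OF subA] by simp
    have AS: "A \<subseteq> carrier (?M Mod N)" using subgroup.subset[OF subA] .
    have "N \<in> A" using subgroup.one_closed[OF subA] by simp
    then have NA: "N \<subseteq> \<Union>A" by blast
    show ?thesis
    proof (cases "\<Union>A = H")
      case True
      have "N #>\<^bsub>?M\<^esub> x \<in> A" if "x \<in> H" for x
      proof -
        have "x \<in> \<Union>A" using that by (simp only: True)
        then show ?thesis unfolding char by (elim CollectE conjE)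
      qed
      then have "carrier (?M Mod N) \<subseteq> A" unfolding carS by (rule image_subsetI)
      then show ?thesis using AS by blast
    next
      case False
      then have "card (\<Union>A) \<le> card N" using maxN[of "\<Union>A"] N.factgroup_subgroup_union_normal[OF A] by blast
      moreover have "finite (\<Union>A)" using char finH by simp
      ultimately have UN: "\<Union>A = N" using NA card_seteq[of "\<Union>A" N] by blast
      have "C = N" if C: "C \<in> A" for C
      proof -
        obtain x where x: "x \<in> H" "C = N #>\<^bsub>?M\<^esub> x" using C AS carS by blast
        then have "x \<in> N" using char UN C by blast
        then show ?thesis using x M.coset_join2[of x N] N.subgroup_axioms by simp
      qed
      then have "A = {N}" using \<open>N \<in> A\<close> by blast
      then show ?thesis by simp
    qed
  qed
  have ord: "1 < order (?M Mod N)"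
  proof -
    have "order (?M Mod N) * card N = card H"
      using M.lagrange[OF N.subgroup_axioms] by (simp add: order_def FactGroup_def)
    then have "order (?M Mod N) \<noteq> 0" "order (?M Mod N) \<noteq> 1" using \<open>card N < card H\<close> by (metis mult_0 not_less0, metis mult_1 less_irrefl)
    then show ?thesis by linarith
  qed
  have "finite_nonabelian_simple_group (?M Mod N)"
    using S.is_group ord simp finS nab
    by (intro finite_nonabelian_simple_group.intro simple_group.intro simple_group_axioms.intro
        finite_nonabelian_simple_group_axioms.intro)
  then show ?thesis using that H(1) N(1) by blast
qed

text \<open>
  The subgroups of the section correspond to the subgroups of \<open>G\<close> between \<open>N\<close> and \<open>H\<close>. If these are
  all the subgroups, then the trivial subgroup and \<open>G\<close> are among them.
\<close>
lemma (in group) num_subgroups_section: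
  assumes fin: "finite (carrier G)" and H: "subgroup H G" and N: "N \<lhd> G\<lparr>carrier := H\<rparr>"
  shows "num_subgroups (G\<lparr>carrier := H\<rparr> Mod N) \<le> num_subgroups G"
    and "num_subgroups (G\<lparr>carrier := H\<rparr> Mod N) = num_subgroups G \<Longrightarrow> H = carrier G \<and> N = {\<one>}"
proof -
  let ?M = "G\<lparr>carrier := H\<rparr>" and ?B = "{K. subgroup K G \<and> (N \<subseteq> K \<and> K \<subseteq> H)}"
  interpret N: normal N ?M using N .
  have finB: "finite ?B" and finAll: "finite {K. subgroup K G}"
    using finite_subgroups[OF fin, of "\<lambda>_. True"] finite_subgroups[OF fin] by simp_all
  have "inj_on Union {A. subgroup A (?M Mod N)}"
  proof (rule inj_onI)
    fix A B assume A: "A \<in> {A. subgroup A (?M Mod N)}" and B: "B \<in> {A. subgroup A (?M Mod N)}" and eq: "\<Union>A = \<Union>B"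
    have "A = rcosets\<^bsub>?M\<lparr>carrier := \<Union>A\<rparr>\<^esub> N" using N.factgroup_subgroup_union_factor A by blast
    moreover have "B = rcosets\<^bsub>?M\<lparr>carrier := \<Union>B\<rparr>\<^esub> N" using N.factgroup_subgroup_union_factor B by blast
    ultimately show "A = B" using eq by simp
  qed
  moreover have "Union ` {A. subgroup A (?M Mod N)} \<subseteq> ?B"
  proof
    fix K assume "K \<in> Union ` {A. subgroup A (?M Mod N)}"
    then obtain A where A: "subgroup A (?M Mod N)" and K: "K = \<Union>A" by blast
    have KM: "subgroup K ?M" using N.factgroup_subgroup_union_subgroup[OF A] K by simp
    moreover have "N \<in> A" using subgroup.one_closed[OF A] by simp
    ultimately show "K \<in> ?B" using incl_subgroup[OF H KM] subgroup.subset[OF KM] K by auto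
  qed
  ultimately have le: "num_subgroups (?M Mod N) \<le> card ?B"
    unfolding num_subgroups_def using finB by (rule card_inj_on_le)
  have sub: "?B \<subseteq> {K. subgroup K G}" by blast
  then have "card ?B \<le> num_subgroups G" unfolding num_subgroups_def by (rule card_mono[OF finAll])
  then show "num_subgroups (?M Mod N) \<le> num_subgroups G" using le by linarith
  assume "num_subgroups (?M Mod N) = num_subgroups G"
  then have "?B = {K. subgroup K G}"
    using le card_seteq[OF finAll sub] unfolding num_subgroups_def by simp
  then have "{\<one>} \<in> ?B" "carrier G \<in> ?B" using triv_subgroup subgroup_self by simp_all
  then have "N \<subseteq> {\<one>}" "carrier G \<subseteq> H" by simp_all
  moreover have "\<one> \<in> N" using subgroup.one_closed[OF N.subgroup_axioms] by simp
  ultimately show "H = carrier G \<and> N = {\<one>}" using subgroup.subset[OF H]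
    by (intro conjI equalityI) simp_all
qed

section \<open>Involutions of the alternating group of degree five\<close>

lemma (in group) involutions_le_subgroup_count:
  assumes fin: "finite (carrier G)"
  shows "card {x \<in> carrier G. x \<noteq> \<one> \<and> x \<otimes> x = \<one>} \<le> subgroup_count G 2"
  unfolding subgroup_count_def
proof (rule card_inj_on_le[where f = "\<lambda>x. {\<one>, x}"])
  show "inj_on (\<lambda>x. {\<one>, x}) {x \<in> carrier G. x \<noteq> \<one> \<and> x \<otimes> x = \<one>}"
    by (rule inj_onI) (auto simp: doubleton_eq_iff)
  show "(\<lambda>x. {\<one>, x}) ` {x \<in> carrier G. x \<noteq> \<one> \<and> x \<otimes> x = \<one>} \<subseteq> {H. subgroup H G \<and> card H = 2}"
  proof (rule image_subsetI)
    fix x assume "x \<in> {x \<in> carrier G. x \<noteq> \<one> \<and> x \<otimes> x = \<one>}"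
    then have x: "x \<in> carrier G" "x \<noteq> \<one>" "x \<otimes> x = \<one>" by simp_all
    have "inv x = x" using inv_equality[OF x(3) x(1) x(1)] .
    then have "subgroup {\<one>, x} G" using x by (intro subgroupI) auto
    moreover have "card {\<one>, x} = 2" using x(2) by simp
    ultimately show "{\<one>, x} \<in> {H. subgroup H G \<and> card H = 2}" by simp
  qed
  show "finite {H. subgroup H G \<and> card H = 2}" using finite_subgroups[OF fin] .
qed

text \<open>
  The 15 unordered pairs of disjoint two-element subsets \<open>{a, b}\<close> and \<open>{c, d}\<close> of \<open>{1..5}\<close>; they
  index the double transpositions.
\<close>
definition disjoint_pairs :: "(nat \<times> nat \<times> nat \<times> nat) list" where
  "disjoint_pairs =
    [(1,2,3,4), (1,3,2,4), (1,4,2,3), (1,2,3,5), (1,3,2,5), (1,5,2,3), (1,2,4,5), (1,4,2,5),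
     (1,5,2,4), (1,3,4,5), (1,4,3,5), (1,5,3,4), (2,3,4,5), (2,4,3,5), (2,5,3,4)]"

lemma double_transposition_involution:
  fixes a b c d :: nat
  assumes "distinct [a, b, c, d]" "{a, b, c, d} \<subseteq> {1..5}"
  defines "p \<equiv> transpose a b \<circ> transpose c d"
  shows "p \<in> carrier (alt_group 5) \<and> p \<noteq> id \<and> p \<circ> p = id"
proof (intro conjI)
  have "p permutes {1..5}"
    unfolding p_def using assms(2) by (intro permutes_compose permutes_swap_id) auto
  moreover have "evenperm p"
    unfolding p_def using assms(1)
    by (subst evenperm_comp) (auto simp: evenperm_swap permutation_swap_id)
  ultimately show "p \<in> carrier (alt_group 5)" by (simp add: alt_group_carrier)
  have "p a = b" unfolding p_def using assms(1) by (simp add: transpose_def)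
  then show "p \<noteq> id" using assms(1) by auto
  show "p \<circ> p = id"
    unfolding p_def using assms(1) by (auto simp: fun_eq_iff transpose_def)
qed

lemma alt_group_5_involutions:
  "15 \<le> card {p \<in> carrier (alt_group 5). p \<noteq> \<one>\<^bsub>alt_group 5\<^esub> \<and> p \<otimes>\<^bsub>alt_group 5\<^esub> p = \<one>\<^bsub>alt_group 5\<^esub>}"
proof -
  let ?I = "{p \<in> carrier (alt_group 5). p \<noteq> \<one>\<^bsub>alt_group 5\<^esub> \<and> p \<otimes>\<^bsub>alt_group 5\<^esub> p = \<one>\<^bsub>alt_group 5\<^esub>}"
  let ?F = "\<lambda>(a, b, c, d). transpose a b \<circ> transpose c d" and ?L = disjoint_pairs
  have L: "\<forall>(a, b, c, d) \<in> set ?L. distinct [a, b, c, d] \<and> {a, b, c, d} \<subseteq> {1..5}"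
    unfolding disjoint_pairs_def by simp
  have sub: "?F ` set ?L \<subseteq> ?I"
  proof (rule image_subsetI)
    fix q assume q: "q \<in> set ?L"
    obtain a b c d where abcd: "q = (a, b, c, d)" by (cases q)
    then have "distinct [a, b, c, d]" "{a, b, c, d} \<subseteq> {1..5}" using L q by fast+
    then show "?F q \<in> ?I" using double_transposition_involution[of a b c d]
      unfolding abcd by (simp add: alt_group_one alt_group_mult)
  qed
  have "distinct (map (\<lambda>p. map p [1, 2, 3, 4, 5]) (map ?F ?L))"
    unfolding disjoint_pairs_def by (simp add: transpose_def)
  then have "distinct (map ?F ?L)" unfolding distinct_map by blast
  then have "card (set (map ?F ?L)) = length (map ?F ?L)" by (rule distinct_card)
  then have "card (?F ` set ?L) = 15" by (simp add: disjoint_pairs_def)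
  moreover have "finite ?I"
  proof (rule finite_subset)
    show "?I \<subseteq> {p. p permutes {1..5}}" by (auto simp: alt_group_carrier)
  qed (simp add: finite_permutations)
  ultimately show ?thesis using card_mono[OF _ sub] by simp
qed

lemma (in group) iso_alt_group_5_involutions:
  assumes fin: "finite (carrier G)" and iso: "G \<cong> alt_group 5"
  shows "15 \<le> subgroup_count G 2"
proof -
  obtain h where h: "h \<in> iso G (alt_group 5)" using iso unfolding is_iso_def by blast
  interpret h: group_hom G "alt_group 5" h
    using h is_group alt_group_is_group by (intro group_hom.intro group_hom_axioms.intro) (simp_all add: iso_def)
  let ?I = "{p \<in> carrier (alt_group 5). p \<noteq> \<one>\<^bsub>alt_group 5\<^esub> \<and> p \<otimes>\<^bsub>alt_group 5\<^esub> p = \<one>\<^bsub>alt_group 5\<^esub>}"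
  let ?J = "{x \<in> carrier G. x \<noteq> \<one> \<and> x \<otimes> x = \<one>}"
  have bij: "bij_betw h (carrier G) (carrier (alt_group 5))" using h by (simp add: iso_def)
  have "?I \<subseteq> h ` ?J"
  proof
    fix p assume p: "p \<in> ?I"
    then obtain x where x: "x \<in> carrier G" "p = h x" using bij by (auto simp: bij_betw_def)
    have "h (x \<otimes> x) = h \<one>" using p x by simp
    then have "x \<otimes> x = \<one>" using bij x(1) by (meson bij_betw_def inj_onD m_closed one_closed)
    moreover have "x \<noteq> \<one>" using p x by auto
    ultimately show "p \<in> h ` ?J" using x by blast
  qed
  moreover have finJ: "finite ?J" using fin by simp
  ultimately have "card ?I \<le> card ?J" by (meson surj_card_le)
  then show ?thesis using alt_group_5_involutions involutions_le_subgroup_count[OF fin] by linarith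
qed

text \<open>
  A subgroup of order 12 has index five, and the resulting embedding into the alternating group is
  onto because both groups have order 60.
\<close>
lemma (in finite_nonabelian_simple_group) iso_alt_group_5:
  assumes ord: "order G = 60" and K: "subgroup K G" "card K = 12"
  shows "G \<cong> alt_group 5"
proof -
  have "K \<noteq> carrier G" using ord K(2) by (auto simp: order_def)
  then obtain h where h: "h \<in> hom G (alt_group 5)" "inj_on h (carrier G)"
    using embedding_into_alt_group[OF K(1), of 5] ord K(2) by auto
  have two: "2 * card (carrier (alt_group 5)) = fact 5" by (rule alt_group_card_carrier) simp
  then have c60: "card (carrier (alt_group 5)) = 60" by (simp add: eval_nat_numeral)
  then have finA: "finite (carrier (alt_group 5))" by (metis card.infinite zero_neq_numeral)
  have "h ` carrier G \<subseteq> carrier (alt_group 5)" using h(1) by (auto simp: hom_def)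
  moreover have "card (h ` carrier G) = card (carrier (alt_group 5))"
    using card_image[OF h(2)] ord c60 by (simp add: order_def)
  ultimately have "h ` carrier G = carrier (alt_group 5)" using card_subset_eq[OF finA] by blast
  then have "h \<in> iso G (alt_group 5)" using h by (simp add: iso_def bij_betw_def)
  then show ?thesis by (rule is_isoI)
qed

section \<open>The arithmetic of subgroup counts\<close>

text \<open>
  Everything about the group that the numerical argument uses: \<open>g\<close> is its order and \<open>s d\<close> its
  number of subgroups of order \<open>d\<close>. Separating the numbers from the group keeps the case analysis
  elementary. The bound 57 is \<open>59 - 2\<close>, since the trivial subgroup and the whole group are left out.
  The numbers \<open>c\<close> are sizes of conjugacy classes of subgroups, and \<open>2 * g dvd fact c\<close> records the
  embedding into the alternating group of degree \<open>c\<close>.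
\<close>
locale subgroup_profile =
  fixes g :: nat and s :: "nat \<Rightarrow> nat"
  assumes g_gt_1: "1 < g"
    and not_prime_power: "prime p \<Longrightarrow> g \<noteq> p ^ k"
    and p_subgroups: "prime p \<Longrightarrow> p ^ k dvd g \<Longrightarrow> 0 < s (p ^ k)"
    and conjugacy_class: "\<lbrakk>0 < s d; 1 < d; d < g\<rbrakk> \<Longrightarrow>
      \<exists>c\<le>s d. 2 * g dvd fact c \<and> 0 < s (g div c)"
    and p_class: "\<lbrakk>prime p; 0 < k; p ^ Suc k dvd g\<rbrakk> \<Longrightarrow>
      \<exists>c\<le>s (p ^ k). c * p ^ Suc k dvd g \<and> 2 * g dvd fact c \<and> 0 < s (g div c)"
    and Sylow: "\<lbrakk>prime p; g = p ^ a * m; \<not> p dvd m; 0 < a\<rbrakk> \<Longrightarrow>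
      s (p ^ a) mod p = 1 \<and> s (p ^ a) dvd m \<and> s (p ^ a) \<le> s (g div s (p ^ a)) \<and> 2 * g dvd fact (s (p ^ a))"
    and prime_elements: "\<lbrakk>prime p; prime q; p \<noteq> q\<rbrakk> \<Longrightarrow> (p - 1) * s p + (q - 1) * s q < g"
    and prime_elements_outside: "\<lbrakk>prime p; \<not> p dvd d; 1 < s d\<rbrakk> \<Longrightarrow> (p - 1) * s p + d < g"
    and Sylow_subgroup: "\<lbrakk>prime p; 0 < a; g = p ^ a * m; \<not> p dvd m; k = p ^ a * l; \<not> p dvd l; 0 < s k; k < g\<rbrakk> \<Longrightarrow>
      s (p ^ a) * k dvd g \<or> (\<exists>c>1. c mod p = 1 \<and> c dvd l \<and> c < s (p ^ a))"
    and orders_total: "\<lbrakk>distinct ds; \<forall>d\<in>set ds. 1 < d \<and> d < g\<rbrakk> \<Longrightarrow> sum_list (map s ds) \<le> 57"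
begin

definition proper_order where "proper_order d \<longleftrightarrow> 1 < d \<and> d < g \<and> 0 < s d"

text \<open>
  The orders in the list are distinct, so the counts refer to disjoint sets of subgroups. Nearly every
  contradiction below comes from exhibiting orders whose counts add up to more than 57.
\<close>
lemma total: "distinct ds \<Longrightarrow> \<forall>d\<in>set ds. proper_order d \<Longrightarrow> sum_list (map s ds) \<le> 57"
  using orders_total[of ds] unfolding proper_order_def by simp

lemma proper_order_prime_power:
  assumes "prime p" "0 < k" "p ^ k dvd g"
  shows "proper_order (p ^ k)"
proof -
  have "1 < p ^ k" using prime_gt_1_nat[OF assms(1)] assms(2) by (metis one_less_power)
  moreover have "p ^ k \<le> g" using assms(3) g_gt_1 by (intro dvd_imp_le) auto
  ultimately show ?thesis
    using p_subgroups[OF assms(1,3)] not_prime_power[OF assms(1), of k] unfolding proper_order_def by simp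
qed

lemma proper_order_prime: "prime p \<Longrightarrow> p dvd g \<Longrightarrow> proper_order p"
  using proper_order_prime_power[of p 1] by simp

lemma proper_order_2: "2 dvd g \<Longrightarrow> proper_order 2" using proper_order_prime[of 2] by simp
lemma proper_order_3: "3 dvd g \<Longrightarrow> proper_order 3" using proper_order_prime[of 3] by simp
lemma proper_order_4: "4 dvd g \<Longrightarrow> proper_order 4" using proper_order_prime_power[of 2 2] by simp
lemma proper_order_5: "5 dvd g \<Longrightarrow> proper_order 5" using proper_order_prime[of 5] by simp
lemma proper_order_7: "7 dvd g \<Longrightarrow> proper_order 7" using proper_order_prime[of 7] by simp
lemma proper_order_8: "8 dvd g \<Longrightarrow> proper_order 8" using proper_order_prime_power[of 2 3] by simp
lemma proper_order_9: "9 dvd g \<Longrightarrow> proper_order 9" using proper_order_prime_power[of 3 2] by simp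
lemma proper_order_16: "16 dvd g \<Longrightarrow> proper_order 16" using proper_order_prime_power[of 2 4] by simp

text \<open>
  The count is at least the size of one conjugacy class, which is the index of a proper subgroup.
\<close>
lemma class_ge:
  assumes "\<And>c. 2 * g dvd fact c \<Longrightarrow> M \<le> c" "proper_order d"
  shows "M \<le> s d"
  using conjugacy_class[of d] assms unfolding proper_order_def by (meson le_trans)

lemma prime_le_index: "prime q \<Longrightarrow> q dvd g \<Longrightarrow> 2 * g dvd fact c \<Longrightarrow> q \<le> c"
  by (metis dvd_mult dvd_trans prime_dvd_fact_iff)

text \<open>
  The factorial of 7 is \<open>16 * 315\<close>, so it is divisible by 16 but not by 32.
\<close>
lemma index_ge_8_if_16_dvd: 
  assumes "16 dvd g" "2 * g dvd fact c" shows "8 \<le> c"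
proof (rule ccontr)
  assume "\<not> 8 \<le> c"
  then have "fact c dvd (fact 7 :: nat)" by (intro fact_dvd) simp
  moreover have "2 * 16 dvd 2 * g" using assms(1) by (intro mult_dvd_mono) auto
  ultimately have "2 * 16 dvd (fact 7 :: nat)" using assms(2) dvd_trans by blast
  then show False by (simp add: fact_numeral)
qed

lemma Sylow_proper:
  assumes "prime p" "g = p ^ a * m" "\<not> p dvd m" "0 < a"
  shows "proper_order (p ^ a)" "proper_order (g div s (p ^ a))" "p ^ a dvd g div s (p ^ a)"
    "1 < s (p ^ a)" "s (p ^ a) * (g div s (p ^ a)) = g"
proof -
  let ?n = "s (p ^ a)"
  have n: "?n dvd m" "2 * g dvd fact ?n" "?n \<le> s (g div ?n)" using Sylow[OF assms] by blast+
  show P: "proper_order (p ^ a)" using proper_order_prime_power[OF assms(1,4)] assms(2) by simp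
  have "?n \<noteq> 0" using P unfolding proper_order_def by simp
  moreover have "?n \<noteq> 1" using n(2) g_gt_1 by auto
  ultimately show n1: "1 < ?n" by linarith
  have "p ^ a * ?n dvd g" using n(1) assms(2) by simp
  then obtain t where t: "g = p ^ a * ?n * t" by (rule dvdE)
  then have gn: "g div ?n = p ^ a * t" using n1 by (simp add: mult.assoc mult.left_commute[of _ ?n])
  then show "p ^ a dvd g div ?n" by simp
  show "?n * (g div ?n) = g" using gn t by simp
  have "0 < t" using t g_gt_1 by (cases t) auto
  then have "p ^ a \<le> g div ?n" using gn by simp
  moreover have "g div ?n < g" using n1 g_gt_1 by simp
  ultimately show "proper_order (g div ?n)" using P n(3) n1 unfolding proper_order_def by linarith
qed

text \<open>
  With \<open>n\<close> Sylow subgroups for \<open>L\<close>, each prime power dividing \<open>n\<close> is the order of further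
  subgroups, so the sum of the counts for a list \<open>qs\<close> of such prime powers fits beside \<open>n\<close>. If the
  Sylow subgroup is not its own normaliser, there is more: the \<open>n\<close> normalisers have a different order,
  and \<open>g div (n * L ^ a)\<close> has a prime factor \<open>q\<close>, which supplies a prime power dividing \<open>g\<close> but not
  \<open>n\<close>, hence outside \<open>qs\<close>.
\<close>
lemma Sylow_count_sum_bound:
  assumes L: "prime L" "g = L ^ a * m" "\<not> L dvd m" "0 < a"
    and M: "\<And>c. 2 * g dvd fact c \<Longrightarrow> M \<le> c"
    and qs: "distinct qs" "\<forall>q\<in>set qs. q dvd s (L ^ a) \<and> (\<exists>p k. prime p \<and> 0 < k \<and> q = p ^ k)"
  shows "s (L ^ a) + sum_list (map s qs) \<le> 57"
    and "g \<noteq> s (L ^ a) * L ^ a \<Longrightarrow> 2 * s (L ^ a) + sum_list (map s qs) + M \<le> 57"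
    and "length qs * M \<le> sum_list (map s qs)"
proof -
  let ?n = "s (L ^ a)"
  note Syl = Sylow[OF L] and Sylp = Sylow_proper[OF L]
  have nm: "?n dvd m" and nN: "?n \<le> s (g div ?n)" using Syl by blast+
  have prp: "\<forall>q\<in>set qs. proper_order q"
  proof
    fix q assume "q \<in> set qs"
    then obtain p k where pk: "q dvd ?n" "prime p" "0 < k" "q = p ^ k" using qs(2) by blast
    have "q dvd g" using dvd_trans[OF pk(1)] Sylp(5) by (metis dvd_triv_left)
    then show "proper_order q" using proper_order_prime_power[OF pk(2,3)] pk(4) by simp
  qed
  have notL: "\<forall>q\<in>set qs. \<not> L dvd q" using qs(2) nm L(3) by (meson dvd_trans)
  have La: "L dvd L ^ a" using L(4) by (simp add: dvd_power)
  have LN: "L dvd g div ?n" using La Sylp(3) dvd_trans by blast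
  have Lq: "L ^ a \<notin> set qs" "g div ?n \<notin> set qs" using notL La LN by blast+
  have "sum_list (map (\<lambda>_. M) qs) \<le> sum_list (map s qs)"
    using class_ge[OF M] prp by (intro sum_list_mono) blast
  then show "length qs * M \<le> sum_list (map s qs)" by (simp add: sum_list_triv mult.commute)
  have "sum_list (map s (L ^ a # qs)) \<le> 57"
    using Lq qs(1) prp Sylp(1) by (intro total) simp_all
  then show "?n + sum_list (map s qs) \<le> 57" by simp
  assume ne: "g \<noteq> ?n * L ^ a"
  obtain t where t: "m = ?n * t" using nm by (rule dvdE)
  then have gt: "g = ?n * L ^ a * t" using L(2) by simp
  have "t \<noteq> 1" using ne gt by auto
  then obtain q where q: "prime q" "q dvd t" using prime_factor_nat by blast
  have "?n \<noteq> 0" using Sylp(4) by simp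
  \<comment> \<open>the least power of \<open>q\<close> that does not divide \<open>n\<close>; it divides \<open>g\<close> because \<open>q\<close> divides \<open>t\<close>\<close>
  define x where "x = q ^ Suc (multiplicity q ?n)"
  have "q ^ multiplicity q ?n * q dvd ?n * t" using q(2) by (intro mult_dvd_mono multiplicity_dvd)
  then have xm: "x dvd m" using t by (simp add: x_def mult.commute)
  have xn: "\<not> x dvd ?n" unfolding x_def
    using \<open>?n \<noteq> 0\<close> q(1) by (metis Suc_n_not_le_n not_prime_unit power_dvd_iff_le_multiplicity)
  have "x dvd g" using xm L(2) by simp
  then have px: "proper_order x" unfolding x_def using proper_order_prime_power[OF q(1)] by blast
  have "\<not> L dvd x" using xm L(3) dvd_trans by blast
  then have "x \<noteq> L ^ a" "x \<noteq> g div ?n" using La LN by blast+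
  moreover have "x \<notin> set qs" using xn qs(2) by blast
  moreover have "g div ?n \<noteq> L ^ a" using ne Sylp(5) by metis
  ultimately have "sum_list (map s (L ^ a # (g div ?n) # x # qs)) \<le> 57"
    using Lq qs(1) prp Sylp(1,2) px by (intro total) simp_all
  then show "2 * ?n + sum_list (map s qs) + M \<le> 57" using nN class_ge[OF M px] by simp
qed

lemma prime_power_small:
  "\<exists>p k. prime p \<and> 0 < k \<and> (2::nat) = p ^ k" "\<exists>p k. prime p \<and> 0 < k \<and> (3::nat) = p ^ k"
  "\<exists>p k. prime p \<and> 0 < k \<and> (4::nat) = p ^ k" "\<exists>p k. prime p \<and> 0 < k \<and> (5::nat) = p ^ k"
  "\<exists>p k. prime p \<and> 0 < k \<and> (7::nat) = p ^ k" "\<exists>p k. prime p \<and> 0 < k \<and> (8::nat) = p ^ k"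
  "\<exists>p k. prime p \<and> 0 < k \<and> (9::nat) = p ^ k" "\<exists>p k. prime p \<and> 0 < k \<and> (16::nat) = p ^ k"
  "\<exists>p k. prime p \<and> 0 < k \<and> (27::nat) = p ^ k"
  by (rule exI[of _ 2], rule exI[of _ 1], simp, rule exI[of _ 3], rule exI[of _ 1], simp,
      rule exI[of _ 2], rule exI[of _ 2], simp, rule exI[of _ 5], rule exI[of _ 1], simp,
      rule exI[of _ 7], rule exI[of _ 1], simp, rule exI[of _ 2], rule exI[of _ 3], simp,
      rule exI[of _ 3], rule exI[of _ 2], simp, rule exI[of _ 2], rule exI[of _ 4], simp,
      rule exI[of _ 3], rule exI[of _ 3], simp)

end

lemma prime_le_28:
  fixes L :: nat
  assumes "prime L" "L \<le> 28"
  shows "L \<in> {2, 3, 5, 7, 11, 13, 17, 19, 23}"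
proof -
  have "L \<in> {..28}" using assms(2) by simp
  also have "{..28::nat} = set [0..<29]" by auto
  also have "[0..<29] = [0,1,2,3,4,5,6,7,8,9,10,11,12,13,14,15,16,17,18,19,20,21,22,23,24,25,26,27,28]"
    by (simp add: upt_conv_Cons)
  finally show ?thesis using assms(1) unfolding list.set by (elim insertE emptyE) simp_all
qed

context subgroup_profile begin

text \<open>
  For the largest prime divisor \<open>L\<close> of \<open>g\<close> every index is at least \<open>L\<close>, and all primes dividing \<open>n\<close>
  are smaller than \<open>L\<close>. Since \<open>n\<close> is congruent to 1 modulo \<open>L\<close> and the classes belonging to the
  prime powers dividing \<open>n\<close> each contribute at least \<open>L\<close>, only finitely many pairs \<open>(L, n)\<close>
  remain.
\<close>
lemma largest_prime_cases:
  assumes L: "prime L" "g = L ^ a * m" "\<not> L dvd m" "0 < a"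
    and max: "\<And>q. prime q \<Longrightarrow> q dvd g \<Longrightarrow> q \<le> L"
  defines "n \<equiv> s (L ^ a)"
  shows "(L, n) \<in> {(3,4), (3,16), (5,6), (5,16), (5,36), (7,8), (7,15), (11,12), (13,14)}"
proof -
  have nmod: "n mod L = 1" and nm: "n dvd m" using Sylow[OF L] unfolding n_def by blast+
  have n1: "1 < n" using Sylow_proper(4)[OF L] unfolding n_def .
  have Lg: "L dvd g" using L(2,4) by (simp add: dvd_power)
  have M: "L \<le> c" if "2 * g dvd fact c" for c using prime_le_index[OF L(1) Lg that] .
  have ng: "n dvd g" using nm L(2) by simp
  have small: "q < L" if "prime q" "q dvd n" for q
  proof -
    have "q \<le> L" using max[OF that(1)] that(2) ng dvd_trans by blast
    moreover have "q \<noteq> L" using that(2) nm L(3) dvd_trans by blast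
    ultimately show ?thesis by simp
  qed
  have prune: "n + length qs * L \<le> 57"
    if "distinct qs" "\<forall>q\<in>set qs. q dvd n \<and> (\<exists>p k. prime p \<and> 0 < k \<and> q = p ^ k)" for qs
    using Sylow_count_sum_bound(1,3)[OF L M, folded n_def, OF _ that] by (meson add_le_cancel_left le_trans)
  have Ln: "L < n"
  proof (rule ccontr)
    assume "\<not> L < n"
    moreover have "n \<noteq> L" using nmod by auto
    ultimately have "n mod L = n" by simp
    then show False using nmod n1 by simp
  qed
  obtain q where q: "prime q" "q dvd n" using prime_factor_nat[of n] n1 by auto
  have pr1: "n + L \<le> 57"
    using prune[of "[q]"] q by (simp, metis power_one_right zero_less_one)
  then have "L \<le> 28" using Ln by linarith
  then have Lcases: "L \<in> {2, 3, 5, 7, 11, 13, 17, 19, 23}" using prime_le_28[OF L(1)] by blast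
  have "L \<noteq> 2" using small[OF q] prime_ge_2_nat[OF q(1)] by linarith
  have big: "(5 dvd n \<longrightarrow> 5 < L) \<and> (7 dvd n \<longrightarrow> 7 < L) \<and> (11 dvd n \<longrightarrow> 11 < L) \<and> (13 dvd n \<longrightarrow> 13 < L)
      \<and> (17 dvd n \<longrightarrow> 17 < L) \<and> (19 dvd n \<longrightarrow> 19 < L) \<and> (23 dvd n \<longrightarrow> 23 < L) \<and> (29 dvd n \<longrightarrow> 29 < L)
      \<and> (31 dvd n \<longrightarrow> 31 < L) \<and> (37 dvd n \<longrightarrow> 37 < L) \<and> (41 dvd n \<longrightarrow> 41 < L) \<and> (43 dvd n \<longrightarrow> 43 < L)
      \<and> (47 dvd n \<longrightarrow> 47 < L) \<and> (53 dvd n \<longrightarrow> 53 < L)"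
    using small by simp
  \<comment> \<open>The coefficient of \<open>L\<close> counts prime powers dividing \<open>n\<close>, each the order of at least \<open>L\<close> subgroups.\<close>
  have r4: "4 dvd n \<longrightarrow> n + 2 * L \<le> 57"
    using prune[of "[2,4]"] prime_power_small dvd_trans[of 2 4 n] by auto
  have r9: "9 dvd n \<longrightarrow> n + 2 * L \<le> 57"
    using prune[of "[3,9]"] prime_power_small dvd_trans[of 3 9 n] by auto
  have r10: "10 dvd n \<longrightarrow> n + 2 * L \<le> 57"
    using prune[of "[2,5]"] prime_power_small dvd_trans[of 2 10 n] dvd_trans[of 5 10 n] by auto
  have r35: "35 dvd n \<longrightarrow> n + 2 * L \<le> 57"
    using prune[of "[5,7]"] prime_power_small dvd_trans[of 5 35 n] dvd_trans[of 7 35 n] by auto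
  have r18: "18 dvd n \<longrightarrow> n + 3 * L \<le> 57"
    using prune[of "[2,3,9]"] prime_power_small dvd_trans[of 2 18 n] dvd_trans[of 3 18 n] dvd_trans[of 9 18 n] by auto
  have r27: "27 dvd n \<longrightarrow> n + 3 * L \<le> 57"
    using prune[of "[3,9,27]"] prime_power_small dvd_trans[of 3 27 n] dvd_trans[of 9 27 n] by auto
  have r36: "36 dvd n \<longrightarrow> n + 4 * L \<le> 57"
    using prune[of "[2,3,4,9]"] prime_power_small dvd_trans[of 2 36 n] dvd_trans[of 3 36 n] dvd_trans[of 4 36 n] dvd_trans[of 9 36 n] by auto
  note facts = r4 r9 r10 r35 r18 r27 r36 big
  from Lcases \<open>L \<noteq> 2\<close> consider "L = 3" | "L = 5" | "L = 7" | "L = 11" | "L = 13" | "L = 17" | "L = 19" | "L = 23" by auto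
  then show ?thesis
  proof cases
    case 1
    have "n \<in> {4, 7, 10, 13, 16, 19, 22, 25, 28, 31, 34, 37, 40, 43, 46, 49, 52}" using nmod n1 pr1 unfolding 1 by simp presburger
    then show ?thesis using facts unfolding 1 by (elim insertE emptyE) simp_all
  next
    case 2
    have "n \<in> {6, 11, 16, 21, 26, 31, 36, 41, 46, 51}" using nmod n1 pr1 unfolding 2 by simp presburger
    then show ?thesis using facts unfolding 2 by (elim insertE emptyE) simp_all
  next
    case 3
    have "n \<in> {8, 15, 22, 29, 36, 43, 50}" using nmod n1 pr1 unfolding 3 by simp presburger
    then show ?thesis using facts unfolding 3 by (elim insertE emptyE) simp_all
  next
    case 4
    have "n \<in> {12, 23, 34, 45}" using nmod n1 pr1 unfolding 4 by simp presburger
    then show ?thesis using facts unfolding 4 by (elim insertE emptyE) simp_all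
  next
    case 5
    have "n \<in> {14, 27, 40}" using nmod n1 pr1 unfolding 5 by simp presburger
    then show ?thesis using facts unfolding 5 by (elim insertE emptyE) simp_all
  next
    case 6
    have "n \<in> {18, 35}" using nmod n1 pr1 unfolding 6 by simp presburger
    then show ?thesis using facts unfolding 6 by (elim insertE emptyE) simp_all
  next
    case 7
    have "n \<in> {20}" using nmod n1 pr1 unfolding 7 by simp presburger
    then show ?thesis using facts unfolding 7 by (elim insertE emptyE) simp_all
  next
    case 8
    have "n \<in> {24}" using nmod n1 pr1 unfolding 8 by simp presburger
    then show ?thesis using facts unfolding 8 by (elim insertE emptyE) simp_all
  qed
qed

end

section \<open>Largest prime divisor 3, 11 or 13, or 16 Sylow 5-subgroups\<close>

context subgroup_profile begin

lemma Sylow_decomposition: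
  assumes "prime p" "p dvd g"
  obtains a m where "g = p ^ a * m" "\<not> p dvd m" "0 < a"
proof -
  have "g \<noteq> 0" "\<not> is_unit p" using g_gt_1 assms(1) not_prime_unit by auto
  then obtain m where m: "g = p ^ multiplicity p g * m" "\<not> p dvd m"
    using multiplicity_decompose' by metis
  moreover have "0 < multiplicity p g" using m assms(2) by (cases "multiplicity p g") auto
  ultimately show ?thesis using that by blast
qed

lemma index_ge_7: "7 dvd g \<Longrightarrow> 2 * g dvd fact c \<Longrightarrow> 7 \<le> c"
  using prime_le_index[of 7] by simp

text \<open>
  An index at most 5 would make \<open>g\<close> divide 60, half the factorial of 5.
\<close>
lemma index_ge_6:
  assumes g: "5 dvd g" "\<not> g dvd 60" "2 * g dvd fact c" shows "6 \<le> c"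
proof (rule ccontr)
  assume "\<not> 6 \<le> c"
  then have "fact c dvd (fact 5 :: nat)" by (intro fact_dvd) simp
  then have "2 * g dvd fact 5" using g(3) dvd_trans by blast
  then have "2 * g dvd 2 * 60" by (simp add: fact_numeral)
  then show False using g(2) by simp
qed

lemma class_of_proper:
  "proper_order d \<Longrightarrow> \<exists>c\<le>s d. 2 * g dvd fact c \<and> 0 < s (g div c)"
  by (simp add: proper_order_def conjugacy_class)

lemma not_182: "g \<noteq> 182"
proof
  assume g: "g = 182"
  have "s 7 dvd 26" using Sylow[of 7 1 26] g by simp
  have "s 7 mod 7 = 1" using Sylow[of 7 1 26] g by simp
  moreover have "1 < s 7" using Sylow_proper(4)[of 7 1 26] g by simp
  moreover have "s 7 \<le> 26" using \<open>s 7 dvd 26\<close> by (rule dvd_imp_le) simp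
  ultimately have "s 7 \<in> {8, 15, 22}" by simp presburger
  then show False using \<open>s 7 dvd 26\<close> by (elim insertE emptyE) simp_all
qed

text \<open>
  The Sylow count for 3 must be 22, and the 22 normalisers of order 6 overrun the total.
\<close>
lemma not_132: "g \<noteq> 132"
proof
  assume g: "g = 132"
  have M: "11 \<le> c" if "2 * g dvd fact c" for c using prime_le_index[of 11 c] that g by simp
  have S: "s 3 mod 3 = 1" "s 3 dvd 44" "s 3 \<le> s (132 div s 3)" using Sylow[of 3 1 44] g by simp_all
  have "11 \<le> s 3" using class_ge[OF M proper_order_3] g by simp
  moreover have "s 3 \<le> 44" using S(2) by (rule dvd_imp_le) simp
  ultimately have "s 3 \<in> {13, 16, 19, 22, 25, 28, 31, 34, 37, 40, 43}" using S(1) by simp presburger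
  then have s3: "s 3 = 22" using S(2) by (elim insertE emptyE) simp_all
  then have s6: "22 \<le> s 6" "proper_order 6" using S(3) Sylow_proper(2)[of 3 1 44] g by simp_all
  have "11 \<le> s 2" "11 \<le> s 11" "proper_order 11"
    using class_ge[OF M proper_order_2] class_ge[OF M, of 11] proper_order_prime[of 11] g by simp_all
  then show False using total[of "[11, 3, 6, 2]"] s6 s3 proper_order_2 proper_order_3 g by simp
qed

text \<open>
  The orders \<open>5 ^ a\<close>, 2, 4 and 8 leave at most 17 Sylow 2-subgroups, whose number is a power of 5 and
  at least 8.
\<close>
lemma not_16_times_5_power: "\<not> (g = 16 * 5 ^ a \<and> 0 < a \<and> s (5 ^ a) = 16)"
proof
  assume g: "g = 16 * 5 ^ a \<and> 0 < a \<and> s (5 ^ a) = 16"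
  have M: "8 \<le> c" if "2 * g dvd fact c" for c using index_ge_8_if_16_dvd[OF _ that] g by simp
  have S: "s 16 dvd 5 ^ a" using Sylow[of 2 4 "5 ^ a"] g by simp
  have pr: "proper_order 2" "proper_order 4" "proper_order 8" "proper_order 16" "proper_order (5 ^ a)"
    using proper_order_2 proper_order_4 proper_order_8 proper_order_16 proper_order_prime_power[of 5 a] g by (simp_all add: dvd_mult2)
  have "odd ((5::nat) ^ a)" by simp
  then have "(5::nat) ^ a \<noteq> 2" "(5::nat) ^ a \<noteq> 4" "(5::nat) ^ a \<noteq> 8" "(5::nat) ^ a \<noteq> 16" by fastforce+
  then have "s (5 ^ a) + (s 2 + (s 4 + (s 8 + s 16))) \<le> 57"
    using total[of "[5 ^ a, 2, 4, 8, 16]"] pr by simp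
  moreover have "8 \<le> s 2" "8 \<le> s 4" "8 \<le> s 8" and s16: "8 \<le> s 16" using class_ge[OF M] pr by blast+
  ultimately have le: "s 16 \<le> 17" using g by simp
  obtain j where j: "s 16 = 5 ^ j" using S divides_primepow_nat[of 5 "s 16" a] by auto
  consider "j = 0" | "j = 1" | "2 \<le> j" by linarith
  then show False
  proof cases
    case 3
    then have "(5::nat) ^ 2 \<le> 5 ^ j" by (intro power_increasing) simp_all
    then show ?thesis using j le by simp
  qed (use j s16 in simp_all)
qed

text \<open>
  The sum of the counts is forced to be exactly 57. Then the subgroups of order 2 form a single class
  of size 8, and its normalisers have the new order \<open>2 * 3 ^ a\<close>.
\<close>
lemma not_16_times_3_power: "\<not> (g = 16 * 3 ^ a \<and> 0 < a \<and> s (3 ^ a) = 16)"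
proof
  assume g: "g = 16 * 3 ^ a \<and> 0 < a \<and> s (3 ^ a) = 16"
  have M: "8 \<le> c" if "2 * g dvd fact c" for c using index_ge_8_if_16_dvd[OF _ that] g by simp
  have S: "s 16 dvd 3 ^ a" using Sylow[of 2 4 "3 ^ a"] g by simp
  have pr: "proper_order 2" "proper_order 4" "proper_order 8" "proper_order 16" "proper_order (3 ^ a)"
    using proper_order_2 proper_order_4 proper_order_8 proper_order_16 proper_order_prime_power[of 3 a] g by (simp_all add: dvd_mult2)
  have "odd ((3::nat) ^ a)" by simp
  then have ne: "(3::nat) ^ a \<noteq> 2" "(3::nat) ^ a \<noteq> 4" "(3::nat) ^ a \<noteq> 8" "(3::nat) ^ a \<noteq> 16" by fastforce+
  then have "s (3 ^ a) + (s 2 + (s 4 + (s 8 + s 16))) \<le> 57"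
    using total[of "[3 ^ a, 2, 4, 8, 16]"] pr by simp
  moreover have s8: "8 \<le> s 2" "8 \<le> s 4" "8 \<le> s 8" and s16: "8 \<le> s 16" using class_ge[OF M] pr by blast+
  ultimately have le: "s 16 \<le> 17" using g by simp
  obtain j where j: "s 16 = 3 ^ j" "j \<le> a" using S divides_primepow_nat[of 3 "s 16" a] by auto
  consider "j = 0" | "j = 1" | "j = 2" | "3 \<le> j" by linarith
  then have j2: "j = 2"
  proof cases
    case 4
    then have "(3::nat) ^ 3 \<le> 3 ^ j" by (intro power_increasing) simp_all
    then show ?thesis using j le by simp
  qed (use j s16 in simp_all)
  then have a2: "2 \<le> a" and s16': "s 16 = 9" using j by simp_all
  have nine: "9 \<le> (3::nat) ^ a" using a2 power_increasing[of 2 a "3::nat"] by simp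
  then have a3: "(3::nat) ^ a \<noteq> 3" by simp
  have "3 dvd g" using g by (simp add: dvd_mult dvd_power)
  then have p3: "proper_order 3" using proper_order_3 by blast
  then have "s (3 ^ a) + (s 2 + (s 4 + (s 8 + (s 16 + s 3)))) \<le> 57"
    using total[of "[3 ^ a, 2, 4, 8, 16, 3]"] pr ne a3 by simp
  moreover have "8 \<le> s 3" using class_ge[OF M p3] .
  ultimately have tight: "s 2 = 8" "s (3 ^ a) + (s 2 + (s 4 + (s 8 + (s 16 + s 3)))) = 57"
    using s8 s16' g by linarith+
  obtain c where c: "c \<le> s 2" "2 * g dvd fact c" "0 < s (g div c)"
    using class_of_proper[OF pr(1)] by blast
  have "c = 8" using M[OF c(2)] c(1) tight(1) by simp
  then have "0 < s (2 * 3 ^ a)" using c(3) g by simp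
  then have px: "proper_order (2 * 3 ^ a)" using g pr(5) unfolding proper_order_def by simp
  have "2 * y \<notin> {2, 4, 8, 16, 3, y}" if "9 \<le> y" for y :: nat using that by auto
  then have "2 * 3 ^ a \<notin> {2, 4, 8, 16, 3, (3::nat) ^ a}" using nine by blast
  then have "s (2 * 3 ^ a) + (s (3 ^ a) + (s 2 + (s 4 + (s 8 + (s 16 + s 3))))) \<le> 57"
    using total[of "[2 * 3 ^ a, 3 ^ a, 2, 4, 8, 16, 3]"] pr ne a3 p3 px by simp
  then show False using tight(2) px unfolding proper_order_def by linarith
qed

lemma not_12: "g \<noteq> 12"
proof
  assume g: "g = 12"
  have S: "s 4 dvd 3" "24 dvd (fact (s 4) :: nat)" using Sylow[of 2 2 3] g by simp_all
  have "s 4 \<le> 3" using S(1) by (rule dvd_imp_le) simp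
  then have "s 4 \<in> {0, 1, 2, 3}" by auto
  then show False using S(2) by (elim insertE emptyE) (simp_all add: fact_numeral)
qed

end

section \<open>Largest prime divisor 7\<close>

context subgroup_profile begin

text \<open>
  The count is congruent to 1 modulo 5 and at least 7; the value 11 is excluded because it would be a
  prime divisor of \<open>g\<close> larger than 7.
\<close>
lemma Sylow_5_ge_16:
  assumes g: "7 dvd g" "5 dvd g" and max: "\<And>q. prime q \<Longrightarrow> q dvd g \<Longrightarrow> q \<le> 7"
    and e: "g = 5 ^ e * m" "\<not> 5 dvd m" "0 < e"
  shows "16 \<le> s (5 ^ e)"
proof -
  have S: "s (5 ^ e) mod 5 = 1" "s (5 ^ e) dvd m" using Sylow[of 5 e m] e by simp_all
  have "7 \<le> s (5 ^ e)"
    using class_ge[OF index_ge_7[OF g(1)] Sylow_proper(1)[of 5 e m]] e by simp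
  moreover have "s (5 ^ e) \<noteq> 11" using max[of 11] S(2) e(1) by (auto simp: dvd_mult)
  ultimately show ?thesis using S(1) by presburger
qed

text \<open>
  At least 16 Sylow 5-subgroups leave no room for 15 normalisers besides the 15 Sylow 7-subgroups, so
  \<open>g = 15 * 7 ^ a\<close>. Then all Sylow counts are forced and \<open>g = 105\<close>; here the normaliser of a Sylow
  3-subgroup has order 15, so it normalises its Sylow 5-subgroup, whose normaliser has order only 5.
\<close>
lemma not_7_15:
  assumes g: "g = 7 ^ a * m" "\<not> 7 dvd m" "0 < a" and s7: "s (7 ^ a) = 15"
    and max: "\<And>q. prime q \<Longrightarrow> q dvd g \<Longrightarrow> q \<le> 7"
  shows False
proof -
  have "15 dvd m" using Sylow[of 7 a m] g s7 by simp
  then have g15: "15 dvd g" using g(1) by simp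
  have g3: "3 dvd g" and g5: "5 dvd g" using dvd_trans[OF _ g15] by simp_all
  have g7: "7 dvd g" using g by (simp add: dvd_power)
  have M: "7 \<le> c" if "2 * g dvd fact c" for c using index_ge_7[OF g7 that] .
  have p3: "proper_order 3" and p5: "proper_order 5" using proper_order_3 g3 proper_order_5 g5 by blast+
  have qs: "\<forall>q\<in>set [3, 5]. q dvd s (7 ^ a) \<and> (\<exists>p k. prime p \<and> 0 < k \<and> q = p ^ k)"
    using prime_power_small s7 by simp
  have sum1: "15 + (s 3 + s 5) \<le> 57" and sum2: "g \<noteq> 15 * 7 ^ a \<Longrightarrow> 30 + (s 3 + s 5) + 7 \<le> 57"
    using Sylow_count_sum_bound(1,2)[of 7 a m 7 "[3, 5]"] g M qs s7 by simp_all
  have s3: "7 \<le> s 3" and s5: "7 \<le> s 5" using class_ge[OF M] p3 p5 by blast+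
  obtain e k where e: "g = 5 ^ e * k" "\<not> 5 dvd k" "0 < e" using Sylow_decomposition[of 5] g5 by auto
  have big: "16 \<le> s (5 ^ e)" using Sylow_5_ge_16[OF g7 g5 max e] by blast
  show False
  proof (cases "e = 1")
    case False
    then have "2 \<le> e" using e(3) by simp
    then have "(5::nat) ^ 2 dvd 5 ^ e" by (rule le_imp_power_dvd)
    then have g25: "25 dvd g" using e(1) by (simp add: dvd_mult2)
    have "g \<noteq> 15 * 7 ^ a"
    proof
      assume "g = 15 * 7 ^ a"
      then have "5 * 5 dvd 5 * (3 * (7::nat) ^ a)" using g25 by simp
      then have "5 dvd 3 * (7::nat) ^ a" by (simp only: dvd_times_left_cancel_iff) 
      then have "5 dvd (7::nat) ^ a" by (simp add: prime_dvd_mult_iff)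
      then show False using prime_dvd_power[of 5 "7::nat" a] by simp
    qed
    then have N7: "g div 15 \<noteq> 7 ^ a" using g15 by (metis dvd_mult_div_cancel)
    have N: "proper_order (g div 15)" "7 dvd g div 15" "15 \<le> s (g div 15)"
      using Sylow_proper(2,3)[of 7 a m] Sylow[of 7 a m] g s7 dvd_trans[OF dvd_power[of a 7]] by auto
    have p7: "proper_order (7 ^ a)" using Sylow_proper(1)[of 7 a m] g by simp
    have pe: "proper_order (5 ^ e)" using Sylow_proper(1)[of 5 e k] e by simp
    have e5: "(5::nat) ^ e \<noteq> 5" using \<open>2 \<le> e\<close> power_increasing[of 2 e "5::nat"] by auto
    have e3: "(5::nat) ^ e \<noteq> 3" using \<open>2 \<le> e\<close> power_increasing[of 2 e "5::nat"] by auto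
    have n7: "\<not> 7 dvd (5::nat) ^ e" using prime_dvd_power[of 7 "5::nat" e] by auto
    have a7: "7 dvd (7::nat) ^ a" using g(3) by (simp add: dvd_power)
    have "distinct [7 ^ a, g div 15, 3, 5, 5 ^ e]"
      using N7 N(2) n7 a7 e3 e5 by (auto dest: arg_cong[where f = "\<lambda>x. 7 dvd x"])
    then have "15 + (s (g div 15) + (s 3 + (s 5 + s (5 ^ e)))) \<le> 57"
      using total[of "[7 ^ a, g div 15, 3, 5, 5 ^ e]"] p7 N(1) p3 p5 pe s7 by simp
    then show False using N(3) s3 s5 big by linarith
  next
    case True
    then have s5': "16 \<le> s 5" using big by simp
    then have g': "g = 15 * 7 ^ a" using sum2 s3 by linarith
    have S5: "s 5 mod 5 = 1" "s 5 dvd 3 * 7 ^ a"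
    proof -
      have "\<not> 5 dvd 3 * (7::nat) ^ a" using prime_dvd_power[of 5 "7::nat" a] by (auto simp: prime_dvd_mult_iff)
      then show "s 5 mod 5 = 1" "s 5 dvd 3 * 7 ^ a" using Sylow[of 5 1 "3 * 7 ^ a"] g' by simp_all
    qed
    have S3: "s 3 mod 3 = 1" "s 3 dvd 5 * 7 ^ a" "s 3 \<le> s (g div s 3)" "2 * g dvd fact (s 3)"
    proof -
      have "\<not> 3 dvd 5 * (7::nat) ^ a" using prime_dvd_power[of 3 "7::nat" a] by (auto simp: prime_dvd_mult_iff)
      then show "s 3 mod 3 = 1" "s 3 dvd 5 * 7 ^ a" "s 3 \<le> s (g div s 3)" "2 * g dvd fact (s 3)"
        using Sylow[of 3 1 "5 * 7 ^ a"] g' by simp_all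
    qed
    have "s 5 \<le> 35" using sum1 s3 by linarith
    then have "s 5 \<in> {16, 21, 26, 31}" using s5' S5(1) by simp presburger
    moreover have "odd (s 5)" using S5(2) by (metis dvd_trans even_mult_iff odd_numeral even_power)
    moreover have "s 5 \<noteq> 31" using max[of 31] S5(2) g' by (auto dest: dvd_mult[of _ _ 5])
    ultimately have s5v: "s 5 = 21" by (elim insertE emptyE) simp_all
    then have "s 3 \<in> {7, 10, 13, 16, 19}" using sum1 s3 S3(1) by simp presburger
    moreover have "odd (s 3)" using S3(2) by (metis dvd_trans even_mult_iff odd_numeral even_power)
    moreover have "s 3 \<noteq> 13" "s 3 \<noteq> 19" using max[of 13] max[of 19] S3(2) g' by (auto dest: dvd_mult[of _ _ 3])
    ultimately have s3v: "s 3 = 7" by (elim insertE emptyE) simp_all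
    have "a = 1"
    proof (rule ccontr)
      assume "a \<noteq> 1"
      then have "(7::nat) ^ 2 dvd 7 ^ a" using g(3) by (intro le_imp_power_dvd) simp
      then have "49 dvd 2 * g" using g' by (simp add: dvd_mult)
      then have "49 dvd (fact 7 :: nat)" using S3(4) s3v dvd_trans by metis
      then show False by (simp add: fact_numeral)
    qed
    then have g105: "g = 105" using g' by simp
    then have "0 < s 15" using S3(3) s3v by simp
    then show False using Sylow_subgroup[of 5 1 21 15 3] g105 s5v
      by (auto dest!: dvd_imp_le)
  qed
qed

text \<open>
  If 16 divides \<open>g\<close>, every class has at least 8 members. The Sylow 7-subgroups, their normalisers and
  the orders 2, 4, 8 and 16 already account for 48 subgroups, which excludes the prime divisors 5 and 3
  in turn. The number of Sylow 2-subgroups then divides 7, which is too small.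
\<close>
lemma not_7_8_dvd_16:
  assumes g: "g dvd 20160" "7 dvd g" "16 dvd g" and s7: "s 7 = 8" "proper_order (g div 8)" "7 dvd g div 8" "8 \<le> s (g div 8)"
  shows False
proof -
  have M: "8 \<le> c" if "2 * g dvd fact c" for c using index_ge_8_if_16_dvd[OF g(3) that] .
  have "2 dvd g" "4 dvd g" "8 dvd g" using dvd_trans[OF _ g(3)] by simp_all
  then have pr: "proper_order 2" "proper_order 4" "proper_order 8" "proper_order 16" "proper_order 7"
    using proper_order_2 proper_order_4 proper_order_8 proper_order_16 proper_order_7 g by blast+
  then have ge: "8 \<le> s 2" "8 \<le> s 4" "8 \<le> s 8" "8 \<le> s 16" using class_ge[OF M] by blast+
  have "16 dvd 8 * (g div 8)" using g(3) \<open>8 dvd g\<close> by simp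
  then have "2 dvd g div 8" using dvd_times_left_cancel_iff[of "8::nat" 2 "g div 8"] by simp
  then have N2: "g div 8 \<noteq> 7" by auto
  have N: "g div 8 \<noteq> x" if "\<not> 7 dvd x" for x using s7(3) that by blast
  have Nne: "g div 8 \<noteq> 2" "g div 8 \<noteq> 4" "g div 8 \<noteq> 8" "g div 8 \<noteq> 16" "g div 8 \<noteq> 3" "g div 8 \<noteq> 5" "g div 8 \<noteq> 9"
    using N by simp_all
  obtain e m where e: "g = 2 ^ e * m" "\<not> 2 dvd m" "0 < e" using Sylow_decomposition[of 2] \<open>2 dvd g\<close> by auto
  let ?n = "s (2 ^ e)"
  have pe: "proper_order (2 ^ e)" using Sylow_proper(1)[of 2 e m] e by simp
  have n: "?n mod 2 = 1" "?n dvd m" using Sylow[of 2 e m] e by simp_all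
  have n8: "8 \<le> ?n" using class_ge[OF M pe] .
  then have n9: "9 \<le> ?n" using n(1) by presburger
  have not5: "\<not> 5 dvd g"
  proof
    assume g5: "5 dvd g"
    obtain f k where f: "g = 5 ^ f * k" "\<not> 5 dvd k" "0 < f" using Sylow_decomposition[of 5] g5 by auto
    have "f = 1"
    proof (rule ccontr)
      assume "f \<noteq> 1"
      then have "(5::nat) ^ 2 dvd 5 ^ f" using f(3) by (intro le_imp_power_dvd) simp
      then have "25 dvd g" using f(1) by (simp add: dvd_mult2)
      then have "25 dvd (20160::nat)" using g(1) by (rule dvd_trans)
      then show False by simp
    qed
    then have "s 5 mod 5 = 1" using Sylow[of 5 1 k] f by simp
    moreover have "8 \<le> s 5" using class_ge[OF M proper_order_5[OF g5]] .
    ultimately have "11 \<le> s 5" by presburger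
    moreover have "s 7 + (s (g div 8) + (s 2 + (s 4 + (s 8 + (s 16 + s 5))))) \<le> 57"
      using total[of "[7, g div 8, 2, 4, 8, 16, 5]"] pr s7(2) proper_order_5[OF g5] N2 Nne by simp
    ultimately show False using s7 ge by linarith
  qed
  have not3: "\<not> 3 dvd g"
  proof
    assume g3: "3 dvd g"
    have p3: "proper_order 3" and s3: "8 \<le> s 3" using proper_order_3[OF g3] class_ge[OF M] by blast+
    have sum: "s 7 + (s (g div 8) + (s 2 + (s 4 + (s 8 + (s 16 + s 3))))) \<le> 57"
      using total[of "[7, g div 8, 2, 4, 8, 16, 3]"] pr s7(2) p3 N2 Nne by simp
    show False
    proof (cases "e = 4")
      case True
      then have "?n = 9" using sum s7 ge s3 n9 by simp
      then have "9 dvd g" using n(2) e(1) by (simp add: dvd_mult)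
      then have p9: "proper_order 9" using proper_order_9 by blast
      have "s 7 + (s (g div 8) + (s 2 + (s 4 + (s 8 + (s 16 + (s 3 + s 9)))))) \<le> 57"
        using total[of "[7, g div 8, 2, 4, 8, 16, 3, 9]"] pr s7(2) p3 p9 N2 Nne by simp
      then show False using s7 ge s3 class_ge[OF M p9] by linarith
    next
      case False
      have "4 < e"
      proof (rule ccontr)
        assume "\<not> 4 < e"
        then have "e \<le> 3" using False by simp
        then have "(2::nat) ^ e dvd 2 ^ 3" by (rule le_imp_power_dvd)
        then obtain w where w: "(2::nat) ^ 3 = 2 ^ e * w" by (rule dvdE)
        have "2 ^ e * (2 * w) dvd 2 ^ e * m" using g(3) w e(1) by (simp add: mult.left_commute)
        then have "2 * w dvd m" by simp
        then show False using e(2) by (metis dvd_mult_left)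
      qed
      then have big: "32 \<le> (2::nat) ^ e" using power_increasing[of 5 e "2::nat"] by simp
      then have ne: "(2::nat) ^ e \<noteq> 7" "(2::nat) ^ e \<noteq> 2" "(2::nat) ^ e \<noteq> 4" "(2::nat) ^ e \<noteq> 8" "(2::nat) ^ e \<noteq> 16" "(2::nat) ^ e \<noteq> 3"
        by auto
      have "\<not> 7 dvd (2::nat) ^ e" using prime_dvd_power[of 7 "2::nat" e] by auto
      then have "g div 8 \<noteq> 2 ^ e" using N by blast
      then have "s (2 ^ e) + (s 7 + (s (g div 8) + (s 2 + (s 4 + (s 8 + (s 16 + s 3)))))) \<le> 57"
        using total[of "[2 ^ e, 7, g div 8, 2, 4, 8, 16, 3]"] pr s7(2) p3 pe ne N2 Nne by simp
      then show False using s7 ge s3 n9 by linarith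
    qed
  qed
  have "m dvd 20160" using g(1) e(1) by (metis dvd_mult_right)
  have "\<not> 3 dvd m" "\<not> 5 dvd m" using e(1) not3 not5 dvd_mult[of 3 m "2 ^ e"] dvd_mult[of 5 m "2 ^ e"] by auto
  then have "coprime m 2" "coprime m 3" "coprime m 5"
    using e(2) prime_imp_coprime[of 3 m] prime_imp_coprime[of 5 m] by (simp_all add: coprime_commute)
  then have "coprime m (2 ^ 6 * (3 ^ 2 * 5))" by (simp only: coprime_mult_right_iff coprime_power_right_iff simp_thms)
  moreover have "m dvd (2 ^ 6 * (3 ^ 2 * 5)) * 7" using \<open>m dvd 20160\<close> by simp
  ultimately have "m dvd 7" by (simp only: coprime_dvd_mult_right_iff)
  then have "?n dvd 7" using n(2) dvd_trans by blast
  then have "?n \<le> 7" by (rule dvd_imp_le) simp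
  then show False using n8 by simp
qed

text \<open>
  The 48 elements of order 7 leave room for only one subgroup of order 8.
\<close>
lemma not_56: "\<not> (g = 56 \<and> s 7 = 8)"
proof
  assume g: "g = 56 \<and> s 7 = 8"
  then have "1 < s 8" using Sylow_proper(4)[of 2 3 7] by simp
  then show False using prime_elements_outside[of 7 8] g by simp
qed

text \<open>
  The normaliser of a Sylow 7-subgroup has order 21. With 7 Sylow 3-subgroups, it would contain all of
  them, which is impossible in a simple group; it cannot normalise one either, since 21 does not divide
  24. With 28, the normalisers of order 6 are too many.
\<close>
lemma not_168: "\<not> (g = 168 \<and> s 7 = 8)"
proof
  assume g: "g = 168 \<and> s 7 = 8"
  have M: "7 \<le> c" if "2 * g dvd fact c" for c using index_ge_7[OF _ that] g by simp
  have S7: "8 \<le> s 21" "proper_order 21" "proper_order 7"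
    using Sylow[of 7 1 24] Sylow_proper(1,2)[of 7 1 24] g by simp_all
  have mod3: "s 3 mod 3 = 1" and S: "s 3 dvd 56" "s 3 \<le> s (168 div s 3)" using Sylow[of 3 1 56] g by simp_all
  have "7 \<le> s 3" using class_ge[OF M proper_order_3] g by simp
  moreover have "s 3 \<le> 56" using S(1) by (rule dvd_imp_le) simp
  ultimately have "s 3 \<in> {7, 10, 13, 16, 19, 22, 25, 28, 31, 34, 37, 40, 43, 46, 49, 52, 55}"
    using mod3 by simp presburger
  then have "s 3 = 7 \<or> s 3 = 28" using S(1) by (elim insertE emptyE) simp_all
  then show False
  proof
    assume s3: "s 3 = 28"
    then have "28 \<le> s 6" "proper_order 6" using S(2) Sylow_proper(2)[of 3 1 56] g by simp_all
    then show False using total[of "[7, 21, 3, 6]"] s3 S7 proper_order_3 g by simp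
  next
    assume s3: "s 3 = 7"
    have "\<exists>c>1. c mod 3 = 1 \<and> c dvd 7 \<and> c < (7::nat)"
      using Sylow_subgroup[of 3 1 56 21 7] g s3 S7 by simp
    then obtain c where c: "1 < c" "c dvd 7" "c < (7::nat)" by blast
    have "prime (7::nat)" by simp
    then show False using c unfolding prime_nat_iff by blast
  qed
qed

lemma not_280: "\<not> (g = 280 \<and> s 7 = 8)"
proof
  assume g: "g = 280 \<and> s 7 = 8"
  have M: "7 \<le> c" if "2 * g dvd fact c" for c using index_ge_7[OF _ that] g by simp
  have mod5: "s 5 mod 5 = 1" and S: "s 5 dvd 56" using Sylow[of 5 1 56] g by simp_all
  have "7 \<le> s 5" using class_ge[OF M proper_order_5] g by simp
  moreover have "s 7 + s 5 \<le> 57" using total[of "[7, 5]"] proper_order_7 proper_order_5 g by simp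
  ultimately have "s 5 \<in> {11, 16, 21, 26, 31, 36, 41, 46}" using mod5 g by simp presburger
  then show False using S by (elim insertE emptyE) simp_all
qed

lemma not_504: "\<not> (g = 504 \<and> s 7 = 8)"
proof
  assume g: "g = 504 \<and> s 7 = 8"
  have M: "7 \<le> c" if "2 * g dvd fact c" for c using index_ge_7[OF _ that] g by simp
  have S7: "8 \<le> s 63" "proper_order 63" "proper_order 7"
    using Sylow[of 7 1 72] Sylow_proper(1,2)[of 7 1 72] g by simp_all
  have mod3: "s 9 mod 3 = 1" and S: "s 9 dvd 56" "s 9 \<le> s (504 div s 9)" using Sylow[of 3 2 56] g by simp_all
  have pr: "proper_order 2" "proper_order 3" "proper_order 4" "proper_order 8" "proper_order 9"
    using proper_order_2 proper_order_3 proper_order_4 proper_order_8 proper_order_9 g by simp_all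
  then have ge: "7 \<le> s 2" "7 \<le> s 3" "7 \<le> s 4" "7 \<le> s 8" "7 \<le> s 9" using class_ge[OF M] by blast+
  have "s 9 \<le> 56" using S(1) by (rule dvd_imp_le) simp
  then have "s 9 \<in> {7, 10, 13, 16, 19, 22, 25, 28, 31, 34, 37, 40, 43, 46, 49, 52, 55}"
    using mod3 ge(5) by simp presburger
  then have "s 9 = 7 \<or> s 9 = 28" using S(1) by (elim insertE emptyE) simp_all
  then show False
  proof
    assume s9: "s 9 = 28"
    then have "28 \<le> s 18" "proper_order 18" using S(2) Sylow_proper(2)[of 3 2 56] g by simp_all
    then show False using total[of "[7, 63, 9, 18]"] s9 S7 pr g by simp
  next
    assume s9: "s 9 = 7"
    then have "7 \<le> s 72" "proper_order 72" using S(2) Sylow_proper(2)[of 3 2 56] g by simp_all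
    then show False using total[of "[7, 63, 9, 72, 3, 2, 4, 8]"] s9 S7 pr ge g by simp
  qed
qed

lemma not_840_2520: "\<not> (g \<in> {840, 2520} \<and> s 7 = 8)"
proof
  assume g: "g \<in> {840, 2520} \<and> s 7 = 8"
  have M: "7 \<le> c" if "2 * g dvd fact c" for c using index_ge_7[OF _ that] g by auto
  have S7: "8 \<le> s (g div 8)" "proper_order (g div 8)" "proper_order 7" and Nv: "g div 8 \<in> {105, 315}"
    using Sylow[of 7 1 120] Sylow_proper(1,2)[of 7 1 120] Sylow[of 7 1 360] Sylow_proper(1,2)[of 7 1 360] g by auto
  have "s 5 mod 5 = 1" "s 5 dvd 504"
    using Sylow[of 5 1 168] Sylow[of 5 1 504] g dvd_trans[of _ 168 "504::nat"] by auto
  have pr: "proper_order 2" "proper_order 3" "proper_order 4" "proper_order 8" "proper_order 5"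
    using proper_order_2 proper_order_3 proper_order_4 proper_order_8 proper_order_5 g by auto
  then have ge: "7 \<le> s 2" "7 \<le> s 3" "7 \<le> s 4" "7 \<le> s 8" "7 \<le> s 5" using class_ge[OF M] by blast+
  have "s 7 + (s (g div 8) + (s 5 + (s 2 + (s 4 + (s 8 + s 3))))) \<le> 57"
    using total[of "[7, g div 8, 5, 2, 4, 8, 3]"] S7 pr Nv by auto
  then have "s 5 \<le> 13" using S7 ge g by linarith
  then have "s 5 = 11" using ge(5) \<open>s 5 mod 5 = 1\<close> by presburger
  then show False using \<open>s 5 dvd 504\<close> by simp
qed

text \<open>
  The order divides half the factorial of 8 and is divisible by 56, so it is 56 times a divisor of 360.
  If 16 does not divide it, that divisor is odd, which leaves six orders.
\<close>
lemma not_7_8: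
  assumes g: "g = 7 ^ a * m" "\<not> 7 dvd m" "0 < a" and s7: "s (7 ^ a) = 8"
  shows False
proof -
  have S: "8 dvd m" "2 * g dvd (fact 8 :: nat)" "8 \<le> s (g div 8)" using Sylow[of 7 a m] g s7 by simp_all
  have SP: "proper_order (g div 8)" "7 ^ a dvd g div 8" using Sylow_proper(2,3)[of 7 a m] g s7 by simp_all
  have "2 * g dvd 2 * 20160" using S(2) by (simp add: fact_numeral)
  then have g20160: "g dvd 20160" by simp
  have a1: "a = 1"
  proof (rule ccontr)
    assume "a \<noteq> 1"
    then have "(7::nat) ^ 2 dvd 7 ^ a" using g(3) by (intro le_imp_power_dvd) simp
    then have "49 dvd g" using g(1) by (simp add: dvd_mult2)
    then have "49 dvd (20160::nat)" using g20160 by (rule dvd_trans)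
    then show False by simp
  qed
  show False
  proof (cases "16 dvd g")
    case True
    then show False using not_7_8_dvd_16[OF g20160 _ True] g(1) a1 s7 SP S(3) by simp
  next
    case False
    obtain t where t: "m = 8 * t" using S(1) by (rule dvdE)
    then have gt: "g = 56 * t" using g(1) a1 by simp
    have "odd t" using False gt by (auto elim!: evenE)
    have "56 * t dvd 56 * 360" using g20160 gt by simp
    then have "t dvd 2 ^ 3 * 45" by (simp only: nat_mult_dvd_cancel_disj) simp
    moreover have "coprime t (2 ^ 3)" unfolding coprime_power_right_iff using \<open>odd t\<close> by simp
    ultimately have t45: "t dvd 45" by (simp only: coprime_dvd_mult_right_iff)
    then have "t \<le> 45" by (rule dvd_imp_le) simp
    then have "t \<in> set [0..<46]" by simp
    also have "[0..<46] = [0,1,2,3,4,5,6,7,8,9,10,11,12,13,14,15,16,17,18,19,20,21,22,23,24,25,26,27,28,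
      29,30,31,32,33,34,35,36,37,38,39,40,41,42,43,44,45]" by (simp add: upt_conv_Cons)
    finally have "t \<in> {1, 3, 5, 9, 15, 45}" using t45 unfolding list.set by (elim insertE emptyE) simp_all
    then have "g \<in> {56, 168, 280, 504, 840, 2520}" using gt by auto
    then show False using not_56 not_168 not_280 not_504 not_840_2520 s7 a1 by auto
  qed
qed

end

section \<open>Largest prime divisor 5\<close>

context subgroup_profile begin

lemma not_5_36:
  assumes g: "g = 5 ^ a * m" "\<not> 5 dvd m" "0 < a" and s5: "s (5 ^ a) = 36"
  shows False
proof -
  have "36 dvd g" using Sylow[of 5 a m] g s5 by simp
  then have g9: "9 dvd g" using dvd_trans[of 9 36 g] by simp
  have "\<not> 9 dvd (60::nat)" by simp
  then have g60: "\<not> g dvd 60" using g9 dvd_trans by blast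
  have g5: "5 dvd g" using g by (simp add: dvd_power)
  have M: "6 \<le> c" if "2 * g dvd fact c" for c using index_ge_6[OF g5 g60 that] .
  have qs: "\<forall>q\<in>set [2, 4, 3, 9]. q dvd s (5 ^ a) \<and> (\<exists>p k. prime p \<and> 0 < k \<and> q = p ^ k)"
    using prime_power_small s5 by simp
  have "s (5 ^ a) + sum_list (map s [2, 4, 3, 9]) \<le> 57" "length [2, 4, 3, 9::nat] * 6 \<le> sum_list (map s [2, 4, 3, 9])"
    by (rule Sylow_count_sum_bound(1,3)[of 5 a m 6 "[2, 4, 3, 9]"]; use g M qs in simp)+
  then show False using s5 by simp
qed

text \<open>
  There would be 24 elements of order 5 and 20 of order 3.
\<close>
lemma not_30: "\<not> (g = 30 \<and> s 5 = 6)"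
proof
  assume g: "g = 30 \<and> s 5 = 6"
  have mod3: "s 3 mod 3 = 1" and S: "s 3 dvd 10" using Sylow[of 3 1 10] g by simp_all
  have "1 < s 3" using Sylow_proper(4)[of 3 1 10] g by simp
  moreover have "s 3 \<le> 10" using S by (rule dvd_imp_le) simp
  ultimately have "s 3 \<in> {4, 7, 10}" using mod3 by simp presburger
  then have "s 3 = 10" using S by (elim insertE emptyE) simp_all
  then show False using prime_elements[of 5 3] g by simp
qed

text \<open>
  The totals force 9 Sylow 2-subgroups with normalisers of order 10. Such a normaliser contains a unique,
  hence normal, subgroup of order 5, although subgroups of order 5 have normalisers of order 15.
\<close>
lemma not_90: "\<not> (g = 90 \<and> s 5 = 6)"
proof
  assume g: "g = 90 \<and> s 5 = 6"
  have M: "6 \<le> c" if "2 * g dvd fact c" for c using index_ge_6[OF _ _ that] g by simp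
  have S5: "proper_order 15" "6 \<le> s 15" "proper_order 5"
    using Sylow[of 5 1 18] Sylow_proper(1,2)[of 5 1 18] g by simp_all
  have pr: "proper_order 2" "proper_order 3" "proper_order 9" using proper_order_2 proper_order_3 proper_order_9 g by simp_all
  then have ge: "6 \<le> s 2" "6 \<le> s 3" "6 \<le> s 9" using class_ge[OF M] by blast+
  have mod9: "s 9 mod 3 = 1" and S9: "s 9 dvd 10" using Sylow[of 3 2 10] g by simp_all
  have "s 9 \<le> 10" using S9 by (rule dvd_imp_le) simp
  then have "s 9 \<in> {7, 10}" using mod9 ge(3) by simp presburger
  then have s9: "s 9 = 10" using S9 by (elim insertE emptyE) simp_all
  have mod2: "s 2 mod 2 = 1" and S2: "s 2 dvd 45" "s 2 \<le> s (90 div s 2)" using Sylow[of 2 1 45] g by simp_all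
  have "s 5 + (s 15 + (s 9 + (s 2 + s 3))) \<le> 57" using total[of "[5, 15, 9, 2, 3]"] S5 pr by simp
  then have "s 2 \<le> 29" using g S5 s9 ge by linarith
  then have "s 2 \<in> {7, 9, 11, 13, 15, 17, 19, 21, 23, 25, 27, 29}" using mod2 ge(1) by simp presburger
  then have "s 2 = 9 \<or> s 2 = 15" using S2(1) by (elim insertE emptyE) simp_all
  then show False
  proof
    assume s2: "s 2 = 15"
    then have "15 \<le> s 6" "proper_order 6" using S2(2) Sylow_proper(2)[of 2 1 45] g by simp_all
    then show False using total[of "[5, 15, 9, 2, 3, 6]"] S5 pr s2 s9 ge g by simp
  next
    assume s2: "s 2 = 9"
    then have "9 \<le> s 10" using S2(2) by simp
    then have "\<exists>c>1. c mod 5 = 1 \<and> c dvd 2 \<and> c < (6::nat)"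
      using Sylow_subgroup[of 5 1 18 10 2] g by simp
    then obtain c where c: "1 < c" "c mod 5 = 1" "c dvd (2::nat)" by blast
    have "c \<le> 2" using c(3) by (rule dvd_imp_le) simp
    then have "c = 2" using c(1) by simp
    then show False using c(2) by simp
  qed
qed

lemma not_120: "\<not> (g = 120 \<and> s 5 = 6)"
proof
  assume g: "g = 120 \<and> s 5 = 6"
  have M: "6 \<le> c" if "2 * g dvd fact c" for c using index_ge_6[OF _ _ that] g by simp
  have S5: "proper_order 20" "6 \<le> s 20" "proper_order 5"
    using Sylow[of 5 1 24] Sylow_proper(1,2)[of 5 1 24] g by simp_all
  have pr: "proper_order 2" "proper_order 3" "proper_order 4" "proper_order 8" using proper_order_2 proper_order_3 proper_order_4 proper_order_8 g by simp_all
  then have ge: "6 \<le> s 2" "6 \<le> s 3" "6 \<le> s 4" "6 \<le> s 8" using class_ge[OF M] by blast+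
  have mod8: "s 8 mod 2 = 1" and S8: "s 8 dvd 15" using Sylow[of 2 3 15] g by simp_all
  have "s 8 \<le> 15" using S8 by (rule dvd_imp_le) simp
  then have "s 8 \<in> {7, 9, 11, 13, 15}" using mod8 ge(4) by simp presburger
  then have s8: "s 8 = 15" using S8 by (elim insertE emptyE) simp_all
  have mod3: "s 3 mod 3 = 1" and S3: "s 3 dvd 40" "s 3 \<le> s (120 div s 3)" using Sylow[of 3 1 40] g by simp_all
  have "s 5 + (s 20 + (s 8 + (s 2 + (s 4 + s 3)))) \<le> 57" using total[of "[5, 20, 8, 2, 4, 3]"] S5 pr by simp
  then have "s 3 \<le> 18" using g S5 s8 ge by linarith
  then have "s 3 \<in> {7, 10, 13, 16}" using mod3 ge(2) by simp presburger
  then have s3: "s 3 = 10" using S3(1) by (elim insertE emptyE) simp_all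
  then have "10 \<le> s 12" "proper_order 12" using S3(2) Sylow_proper(2)[of 3 1 40] g by simp_all
  then show False using total[of "[5, 20, 8, 2, 4, 3, 12]"] S5 pr s3 s8 ge g by simp
qed

lemma not_180: "\<not> (g = 180 \<and> s 5 = 6)"
proof
  assume g: "g = 180 \<and> s 5 = 6"
  have M: "6 \<le> c" if "2 * g dvd fact c" for c using index_ge_6[OF _ _ that] g by simp
  have S5: "proper_order 30" "6 \<le> s 30" "proper_order 5"
    using Sylow[of 5 1 36] Sylow_proper(1,2)[of 5 1 36] g by simp_all
  have pr: "proper_order 2" "proper_order 3" "proper_order 4" "proper_order 9" using proper_order_2 proper_order_3 proper_order_4 proper_order_9 g by simp_all
  then have ge: "6 \<le> s 2" "6 \<le> s 3" "6 \<le> s 4" "6 \<le> s 9" using class_ge[OF M] by blast+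
  have mod9: "s 9 mod 3 = 1" and S9: "s 9 dvd 20" "s 9 \<le> s (180 div s 9)" using Sylow[of 3 2 20] g by simp_all
  have "s 9 \<le> 20" using S9(1) by (rule dvd_imp_le) simp
  then have "s 9 \<in> {7, 10, 13, 16, 19}" using mod9 ge(4) by simp presburger
  then have s9: "s 9 = 10" using S9(1) by (elim insertE emptyE) simp_all
  then have S18: "10 \<le> s 18" "proper_order 18" using S9(2) Sylow_proper(2)[of 3 2 20] g by simp_all
  have mod4: "s 4 mod 2 = 1" and S4: "s 4 dvd 45" "s 4 \<le> s (180 div s 4)" using Sylow[of 2 2 45] g by simp_all
  have "s 5 + (s 30 + (s 9 + (s 18 + (s 4 + (s 2 + s 3))))) \<le> 57" using total[of "[5, 30, 9, 18, 4, 2, 3]"] S5 S18 pr by simp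
  then have "s 4 \<le> 13" using g S5 s9 S18 ge by linarith
  then have "s 4 \<in> {7, 9, 11, 13}" using mod4 ge(3) by simp presburger
  then have s4: "s 4 = 9" using S4(1) by (elim insertE emptyE) simp_all
  then have "9 \<le> s 20" "proper_order 20" using S4(2) Sylow_proper(2)[of 2 2 45] g by simp_all
  then show False using total[of "[5, 30, 9, 18, 4, 20, 2, 3]"] S5 S18 pr s4 s9 ge g by simp
qed

lemma not_360: "\<not> (g = 360 \<and> s 5 = 6)"
proof
  assume g: "g = 360 \<and> s 5 = 6"
  have M: "6 \<le> c" if "2 * g dvd fact c" for c using index_ge_6[OF _ _ that] g by simp
  have S5: "proper_order 60" "6 \<le> s 60" "proper_order 5"
    using Sylow[of 5 1 72] Sylow_proper(1,2)[of 5 1 72] g by simp_all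
  have pr: "proper_order 2" "proper_order 3" "proper_order 4" "proper_order 8" "proper_order 9"
    using proper_order_2 proper_order_3 proper_order_4 proper_order_8 proper_order_9 g by simp_all
  then have ge: "6 \<le> s 2" "6 \<le> s 3" "6 \<le> s 4" "6 \<le> s 8" "6 \<le> s 9" using class_ge[OF M] by blast+
  have mod8: "s 8 mod 2 = 1" and S8: "s 8 dvd 45" using Sylow[of 2 3 45] g by simp_all
  have "s 8 \<noteq> 7" using S8 by auto
  then have s8: "9 \<le> s 8" using mod8 ge(4) by presburger
  have mod9: "s 9 mod 3 = 1" and S9: "s 9 dvd 40" "s 9 \<le> s (360 div s 9)" using Sylow[of 3 2 40] g by simp_all
  have "s 5 + (s 60 + (s 8 + (s 2 + (s 4 + (s 3 + s 9))))) \<le> 57" using total[of "[5, 60, 8, 2, 4, 3, 9]"] S5 pr by simp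
  then have "s 9 \<le> 18" using g S5 s8 ge by linarith
  then have "s 9 \<in> {7, 10, 13, 16}" using mod9 ge(5) by simp presburger
  then have s9: "s 9 = 10" using S9(1) by (elim insertE emptyE) simp_all
  then have "10 \<le> s 36" "proper_order 36" using S9(2) Sylow_proper(2)[of 3 2 40] g by simp_all
  then show False using total[of "[5, 60, 8, 2, 4, 3, 9, 36]"] S5 pr s9 s8 ge g by simp
qed

text \<open>
  The order divides half the factorial of 6 and is divisible by 30. All the possible orders except 60
  admit too few subgroups of some orders or too many of others.
\<close>
lemma order_60_of_5_6:
  assumes g: "g = 5 ^ a * m" "\<not> 5 dvd m" "0 < a" and s5: "s (5 ^ a) = 6"
  shows "g = 60 \<and> a = 1"
proof -
  have S: "6 dvd m" "2 * g dvd (fact 6 :: nat)" using Sylow[of 5 a m] g s5 by simp_all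
  have "2 * g dvd 2 * 360" using S(2) by (simp add: fact_numeral)
  then have g360: "g dvd 360" by simp
  have a1: "a = 1"
  proof (rule ccontr)
    assume "a \<noteq> 1"
    then have "(5::nat) ^ 2 dvd 5 ^ a" using g(3) by (intro le_imp_power_dvd) simp
    then have "25 dvd g" using g(1) by (simp add: dvd_mult2)
    then have "25 dvd (360::nat)" using g360 by (rule dvd_trans)
    then show False by simp
  qed
  obtain t where t: "m = 6 * t" using S(1) by (rule dvdE)
  then have gt: "g = 30 * t" using g(1) a1 by simp
  have "30 * t dvd 30 * 12" using g360 gt by simp
  then have t12: "t dvd 12" by (simp only: nat_mult_dvd_cancel_disj) simp
  then have "t \<le> 12" by (rule dvd_imp_le) simp
  then have "t \<in> {0, 1, 2, 3, 4, 5, 6, 7, 8, 9, 10, 11, 12}" by simp presburger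
  then have "t \<in> {1, 2, 3, 4, 6, 12}" using t12 by (elim insertE emptyE) simp_all
  then have "g \<in> {30, 60, 90, 120, 180, 360}" using gt by auto
  then show ?thesis using not_30 not_90 not_120 not_180 not_360 s5 a1 by auto
qed

text \<open>
  These counts together with 6 subgroups of order 5 and 15 of order 2 add up to 57. The subgroup of order
  12 is the normaliser of a Sylow 2-subgroup if there are 5 of them. If there are 15, the total leaves at
  most 10 conjugates to a subgroup of order 2 lying in a Sylow 2-subgroup; its normaliser has order
  divisible by 4, which makes its index 5.
\<close>
lemma order_60_counts:
  assumes g: "g = 60" and s5: "s 5 = 6"
  shows "0 < s 12" "5 \<le> s 12" "10 \<le> s 3" "5 \<le> s 4" "10 \<le> s 6" "6 \<le> s 10"
proof -
  have M: "5 \<le> c" if "2 * g dvd fact c" for c using prime_le_index[of 5 c] that g by simp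
  have S5: "proper_order 10" "proper_order 5" and s10: "6 \<le> s 10"
    using Sylow[of 5 1 12] Sylow_proper(1,2)[of 5 1 12] g s5 by simp_all
  have pr: "proper_order 2" "proper_order 3" "proper_order 4" using proper_order_2 proper_order_3 proper_order_4 g by simp_all
  then have ge: "5 \<le> s 2" "5 \<le> s 3" "5 \<le> s 4" using class_ge[OF M] by blast+
  have mod3: "s 3 mod 3 = 1" and S3: "s 3 dvd 20" "s 3 \<le> s (60 div s 3)" using Sylow[of 3 1 20] g by simp_all
  have "s 3 \<le> 20" using S3(1) by (rule dvd_imp_le) simp
  then have "s 3 \<in> {7, 10, 13, 16, 19}" using mod3 ge(2) by simp presburger
  then have s3: "s 3 = 10" using S3(1) by (elim insertE emptyE) simp_all
  then have s6: "10 \<le> s 6" "proper_order 6" using S3(2) Sylow_proper(2)[of 3 1 20] g by simp_all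
  have mod4: "s 4 mod 2 = 1" and S4: "s 4 dvd 15" "s 4 \<le> s (60 div s 4)" using Sylow[of 2 2 15] g by simp_all
  have "s 4 \<le> 15" using S4(1) by (rule dvd_imp_le) simp
  then have "s 4 \<in> {5, 7, 9, 11, 13, 15}" using mod4 ge(3) by simp presburger
  then have s4: "s 4 = 5 \<or> s 4 = 15" using S4(1) by (elim insertE emptyE) simp_all
  show "0 < s 12"
    using s4
  proof
    assume "s 4 = 5"
    then show "0 < s 12" using S4(2) by simp
  next
    assume s4: "s 4 = 15"
    obtain c where c: "c \<le> s 2" "c * 4 dvd 60" "2 * g dvd fact c" "0 < s (g div c)"
      using p_class[of 2 1] g by auto
    have "s 5 + (s 10 + (s 3 + (s 6 + (s 4 + s 2)))) \<le> 57"
      using total[of "[5, 10, 3, 6, 4, 2]"] S5 pr s6 by simp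
    then have "c \<le> 10" using c(1) s5 s10 s3 s6 s4 by linarith
    moreover have "5 \<le> c" using M[OF c(3)] .
    ultimately have "c \<in> {5, 6, 7, 8, 9, 10}" by auto
    then have "c = 5" using c(2) by (elim insertE emptyE) simp_all
    then show "0 < s 12" using c(4) g by simp
  qed
  then have "proper_order 12" using g unfolding proper_order_def by simp
  then show "5 \<le> s 12" using class_ge[OF M] by blast
  show "10 \<le> s 3" "5 \<le> s 4" "10 \<le> s 6" "6 \<le> s 10" using s3 ge s6 s10 by simp_all
qed

section \<open>Only the order 60 remains\<close>

theorem order_60:
  "g = 60 \<and> s 5 = 6"
proof -
  let ?P = "{p. prime p \<and> p dvd g}"
  have "?P \<subseteq> {..g}" using g_gt_1 dvd_imp_le by auto
  then have fin: "finite ?P" using finite_subset by blast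
  have ne: "?P \<noteq> {}" using prime_factor_nat[of g] g_gt_1 by auto
  define L where "L = Max ?P"
  have L: "prime L" "L dvd g" using Max_in[OF fin ne] unfolding L_def by auto
  have max: "q \<le> L" if "prime q" "q dvd g" for q using Max_ge[OF fin] that unfolding L_def by blast
  obtain a m where g: "g = L ^ a * m" "\<not> L dvd m" "0 < a" using Sylow_decomposition[OF L] .
  note dec = L(1) g
  have mem: "(L, s (L ^ a)) \<in> {(3,4), (3,16), (5,6), (5,16), (5,36), (7,8), (7,15), (11,12), (13,14)}"
    using largest_prime_cases[OF dec max] by blast
  have S: "s (L ^ a) dvd m" "2 * g dvd fact (s (L ^ a))" using Sylow[OF dec] by blast+
  \<comment> \<open>If twice \<open>n\<close> and the further classes exceed 57, a Sylow subgroup is its own normaliser.\<close>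
  have exact: "g = s (L ^ a) * L ^ a"
    if "\<And>c. 2 * g dvd fact c \<Longrightarrow> M \<le> c" "distinct qs"
      "\<forall>q\<in>set qs. q dvd s (L ^ a) \<and> (\<exists>p k. prime p \<and> 0 < k \<and> q = p ^ k)"
      "57 < 2 * s (L ^ a) + (length qs + 1) * M" for M qs
    using Sylow_count_sum_bound(2,3)[OF dec that(1-3)] that(4) by fastforce
  have Lidx: "L \<le> c" if "2 * g dvd fact c" for c using prime_le_index[OF L that] .
  consider "L = 3" "s (3 ^ a) = 4" | "L = 3" "s (3 ^ a) = 16" | "L = 5" "s (5 ^ a) = 6" | "L = 5" "s (5 ^ a) = 16"
    | "L = 5" "s (5 ^ a) = 36" | "L = 7" "s (7 ^ a) = 8" | "L = 7" "s (7 ^ a) = 15" | "L = 11" "s (11 ^ a) = 12"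
    | "L = 13" "s (13 ^ a) = 14"
    using mem by auto
  then show ?thesis
  proof cases
    case 1
    then have "4 dvd m" "2 * g dvd (fact 4 :: nat)" using S by simp_all
    then have "2 * g dvd 2 * 12" by (simp add: fact_numeral)
    then have "g dvd 12" by simp
    obtain u where "m = 4 * u" using \<open>4 dvd m\<close> by (rule dvdE)
    moreover have "3 dvd (3::nat) ^ a" using g(3) by (simp add: dvd_power)
    then obtain v where "(3::nat) ^ a = 3 * v" by (rule dvdE)
    ultimately have "12 dvd g" using g(1) 1 by simp
    then have "g = 12" using \<open>g dvd 12\<close> by (simp add: dvd_antisym)
    then show ?thesis using not_12 by blast
  next
    case 2
    have "16 dvd g" using S 2 g(1) by (simp add: dvd_mult)
    then have "g = 16 * 3 ^ a"
      using exact[of 8 "[2, 4, 8, 16]"] index_ge_8_if_16_dvd prime_power_small 2 by simp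
    then show ?thesis using not_16_times_3_power 2 g(3) by blast
  next
    case 3
    then have "g = 60 \<and> a = 1" using order_60_of_5_6[of a m] g by blast
    then show ?thesis using 3 by simp
  next
    case 4
    have "16 dvd g" using S 4 g(1) by (simp add: dvd_mult)
    then have "g = 16 * 5 ^ a"
      using exact[of 8 "[2, 4, 8, 16]"] index_ge_8_if_16_dvd prime_power_small 4 by simp
    then show ?thesis using not_16_times_5_power 4 g(3) by blast
  next
    case 5
    then show ?thesis using not_5_36[of a m] g by simp
  next
    case 6
    then show ?thesis using not_7_8[of a m] g by simp
  next
    case 7
    then show ?thesis using not_7_15[of a m] g max by simp
  next
    case 8
    then have ga: "g = 12 * 11 ^ a"
      using exact[of 11 "[2, 4, 3]"] Lidx prime_power_small by simp
    have "a = 1"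
    proof (rule ccontr)
      assume "a \<noteq> 1"
      then have "(11::nat) ^ 2 dvd 11 ^ a" using g(3) by (intro le_imp_power_dvd) simp
      then have "121 dvd 2 * g" using ga by (simp add: dvd_mult)
      then have "121 dvd (fact 12 :: nat)" using S(2) 8 dvd_trans by metis
      then show False by (simp add: fact_numeral)
    qed
    then show ?thesis using ga not_132 by simp
  next
    case 9
    then have ga: "g = 14 * 13 ^ a"
      using exact[of 13 "[2, 7]"] Lidx prime_power_small by simp
    have "a = 1"
    proof (rule ccontr)
      assume "a \<noteq> 1"
      then have "(13::nat) ^ 2 dvd 13 ^ a" using g(3) by (intro le_imp_power_dvd) simp
      then have "169 dvd 2 * g" using ga by (simp add: dvd_mult)
      then have "169 dvd (fact 14 :: nat)" using S(2) 9 dvd_trans by metis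
      then show False by (simp add: fact_numeral)
    qed
    then show ?thesis using ga not_182 by simp
  qed
qed

end

section \<open>Simple groups with at most 59 subgroups\<close>

context finite_nonabelian_simple_group begin

text \<open>
  The 2 accounts for the trivial subgroup and for \<open>G\<close>.
\<close>
lemma num_subgroups_ge:
  assumes "distinct ds" "\<forall>d\<in>set ds. 1 < d \<and> d < order G"
  shows "2 + sum_list (map (subgroup_count G) ds) \<le> num_subgroups G"
proof -
  let ?S = "\<lambda>d. {H. subgroup H G \<and> card H = d}"
  have finS: "finite (?S d)" for d using finite_subgroups[OF fin] .
  have "sum_list (map (subgroup_count G) ds) = (\<Sum>d\<in>set ds. card (?S d))"
    using assms(1) by (simp add: sum_list_distinct_conv_sum_set subgroup_count_def)
  also have "\<dots> = card (\<Union>d\<in>set ds. ?S d)"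
    by (rule card_UN_disjoint[symmetric]) (use finS in auto)
  finally have sum: "sum_list (map (subgroup_count G) ds) = card (\<Union>d\<in>set ds. ?S d)" .
  have one: "{\<one>} \<noteq> carrier G" using simple_not_triv by simp
  have notin: "{\<one>} \<notin> (\<Union>d\<in>set ds. ?S d)" "carrier G \<notin> (\<Union>d\<in>set ds. ?S d)"
    using assms(2) by (auto simp: order_def)
  have finU: "finite (\<Union>d\<in>set ds. ?S d)" using finS by blast
  have "card (insert {\<one>} (insert (carrier G) (\<Union>d\<in>set ds. ?S d))) = 2 + card (\<Union>d\<in>set ds. ?S d)"
    using one notin finU by simp
  moreover have "insert {\<one>} (insert (carrier G) (\<Union>d\<in>set ds. ?S d)) \<subseteq> {H. subgroup H G}"
    using triv_subgroup subgroup_self by blast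
  then have "card (insert {\<one>} (insert (carrier G) (\<Union>d\<in>set ds. ?S d))) \<le> num_subgroups G"
    unfolding num_subgroups_def using finite_subgroups[OF fin, of "\<lambda>_. True"] by (intro card_mono) simp_all
  ultimately show ?thesis using sum by simp
qed

lemma two_primes_element_count:
  assumes "prime p" "prime q" "p \<noteq> q"
  shows "(p - 1) * subgroup_count G p + (q - 1) * subgroup_count G q < order G"
proof -
  let ?U = "\<lambda>p. \<Union>P\<in>{P. subgroup P G \<and> card P = p}. P - {\<one>}"
  have sub: "?U p \<subseteq> carrier G" for p using subgroup.subset by blast
  have finU: "finite (?U p)" for p using finite_subset[OF sub fin] .
  have ndvd: "\<not> p dvd q" using assms using primes_dvd_imp_eq by blast
  have "?U p \<inter> ?U q = {}"
    using prime_order_elements_disjoint[OF assms(1) _ _ _ _ fin] ndvd by blast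
  then have "card (?U p \<union> ?U q) = card (?U p) + card (?U q)" by (intro card_Un_disjoint finU)
  moreover have "?U p \<union> ?U q \<subset> carrier G"
  proof (rule psubsetI)
    show "?U p \<union> ?U q \<subseteq> carrier G" using sub by (intro Un_least)
    have "\<one> \<notin> ?U p \<union> ?U q" by blast
    then show "?U p \<union> ?U q \<noteq> carrier G" using one_closed by metis
  qed
  then have "card (?U p \<union> ?U q) < order G" unfolding order_def by (rule psubset_card_mono[OF fin])
  ultimately show ?thesis
    using card_prime_order_elements[OF fin assms(1)] card_prime_order_elements[OF fin assms(2)] by simp
qed

text \<open>
  Two different subgroups of order \<open>d\<close> have more than \<open>d\<close> elements in their union, none of which
  has order \<open>p\<close>.
\<close>
lemma element_count_strict:
  assumes "prime p" "\<not> p dvd d" "1 < subgroup_count G d"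
  shows "(p - 1) * subgroup_count G p + d < order G"
proof -
  let ?S = "{H. subgroup H G \<and> card H = d}"
  have finS: "finite ?S" using finite_subgroups[OF fin] .
  have cS: "1 < card ?S" using assms(3) unfolding subgroup_count_def .
  obtain H where H: "H \<in> ?S" using subgroup_count_posD[of d] assms(3) by auto
  have "?S \<noteq> {H}"
  proof
    assume "?S = {H}"
    then have "card ?S = 1" by simp
    then show False using cS by linarith
  qed
  then obtain K where K: "K \<in> ?S" "K \<noteq> H" using H by blast
  have "\<Union>?S \<subseteq> carrier G" by (intro Union_least) (simp add: subgroup.subset)
  then have finU: "finite (\<Union>?S)" using fin by (rule finite_subset)
  have finK: "finite K" using finU K(1) finite_subset[of K "\<Union>?S"] by blast
  have "\<not> K \<subseteq> H"
  proof
    assume "K \<subseteq> H"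
    moreover have "finite H" using finU H finite_subset[of H "\<Union>?S"] by blast
    ultimately show False using card_subset_eq[of H K] H K by simp
  qed
  then have "H \<subset> \<Union>?S" using H K by blast
  then have "card H < card (\<Union>?S)" by (rule psubset_card_mono[OF finU])
  then have "d < card (\<Union>?S)" using H by simp
  then show ?thesis using element_count[OF fin assms(1,2)] by linarith
qed

end

locale few_subgroups_group = finite_nonabelian_simple_group +
  assumes few: "num_subgroups G \<le> 59"
begin

lemma profile: "subgroup_profile (order G) (subgroup_count G)"
proof
  show "1 < order G" by (rule order_gt_one)
next
  fix p k :: nat assume "prime p"
  then show "order G \<noteq> p ^ k" by (rule order_not_prime_power)
next
  fix p k :: nat assume p: "prime p" "p ^ k dvd order G"
  obtain m where "order G = p ^ k * m" using p(2) by (rule dvdE)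
  then obtain H where H: "subgroup H G" "card H = p ^ k" using sylow_thm[OF p(1) is_group _ fin] by blast
  then show "0 < subgroup_count G (p ^ k)" using subgroup_count_pos[OF fin H(1)] by simp
next
  fix d assume "0 < subgroup_count G d" "1 < d" "d < order G"
  then show "\<exists>c\<le>subgroup_count G d. 2 * order G dvd fact c \<and> 0 < subgroup_count G (order G div c)"
    by (rule conjugacy_class_of_order)
next
  fix p k :: nat assume "prime p" "0 < k" "p ^ Suc k dvd order G"
  then show "\<exists>c\<le>subgroup_count G (p ^ k). c * p ^ Suc k dvd order G \<and> 2 * order G dvd fact c
    \<and> 0 < subgroup_count G (order G div c)"
    by (rule conjugacy_class_of_p_subgroup)
next
  fix p a m :: nat assume a: "prime p" "order G = p ^ a * m" "\<not> p dvd m" "0 < a"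
  show "subgroup_count G (p ^ a) mod p = 1 \<and> subgroup_count G (p ^ a) dvd m \<and>
    subgroup_count G (p ^ a) \<le> subgroup_count G (order G div subgroup_count G (p ^ a)) \<and>
    2 * order G dvd fact (subgroup_count G (p ^ a))"
    using Sylow_counts(1,2,4)[OF fin a(1-3)] order_dvd_fact_Sylow_count[OF a] by blast
next
  fix p q :: nat assume "prime p" "prime q" "p \<noteq> q"
  then show "(p - 1) * subgroup_count G p + (q - 1) * subgroup_count G q < order G" by (rule two_primes_element_count)
next
  fix p d :: nat assume "prime p" "\<not> p dvd d" "1 < subgroup_count G d"
  then show "(p - 1) * subgroup_count G p + d < order G" by (rule element_count_strict)
next
  fix p a m k l :: nat
  assume a: "prime p" "0 < a" "order G = p ^ a * m" "\<not> p dvd m" "k = p ^ a * l" "\<not> p dvd l"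
    "0 < subgroup_count G k" "k < order G"
  obtain K where K: "subgroup K G" "card K = k" using subgroup_count_posD[OF a(7)] .
  have "K \<noteq> carrier G" using K(2) a(8) by (auto simp: order_def)
  then show "subgroup_count G (p ^ a) * k dvd order G \<or> (\<exists>c>1. c mod p = 1 \<and> c dvd l \<and> c < subgroup_count G (p ^ a))"
    using Sylow_in_proper_subgroup[OF K(1) _ a(1,2) _ a(6,3,4)] K(2) a(5) by simp
next
  fix ds :: "nat list" assume "distinct ds" "\<forall>d\<in>set ds. 1 < d \<and> d < order G"
  then show "sum_list (map (subgroup_count G) ds) \<le> 57" using num_subgroups_ge[of ds] few by linarith
qed

text \<open>
  The lower bound on the number of subgroups is needed as well: it shows that a proper section of a group
  with 59 subgroups cannot be simple and nonabelian.
\<close>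
theorem iso_alt_group_5_and_59: "G \<cong> alt_group 5 \<and> num_subgroups G = 59"
proof -
  interpret P: subgroup_profile "order G" "subgroup_count G" by (rule profile)
  have ord: "order G = 60" and s5: "subgroup_count G 5 = 6" using P.order_60 by blast+
  note counts = P.order_60_counts[OF ord s5]
  obtain K where K: "subgroup K G" "card K = 12" using subgroup_count_posD[OF counts(1)] .
  have iso: "G \<cong> alt_group 5" using iso_alt_group_5[OF ord K] .
  have s2: "15 \<le> subgroup_count G 2" using iso_alt_group_5_involutions[OF fin iso] .
  have "2 + sum_list (map (subgroup_count G) [2, 3, 4, 5, 6, 10, 12]) \<le> num_subgroups G"
    by (rule num_subgroups_ge) (simp_all add: ord)
  then have "59 \<le> num_subgroups G" using counts s5 s2 by simp
  then show ?thesis using iso few by simp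
qed

end

theorem theorem2p2:
  fixes G :: "('a, 'b) monoid_scheme"
  assumes "group G"
    and "finite (carrier G)"
    and "\<not> solvable G"
    and "num_subgroups G = 59"
  shows "G \<cong> alt_group 5"
proof -
  interpret group G by fact
  obtain H N where H: "subgroup H G" and N: "N \<lhd> G\<lparr>carrier := H\<rparr>"
    and simple: "finite_nonabelian_simple_group (G\<lparr>carrier := H\<rparr> Mod N)"
    using nonsolvable_simple_section[OF assms(2,3)] .
  note sec = num_subgroups_section[OF assms(2) H N]
  have "few_subgroups_group (G\<lparr>carrier := H\<rparr> Mod N)"
    using simple sec(1) assms(4) by (simp add: few_subgroups_group_def few_subgroups_group_axioms_def)
  then have iso: "G\<lparr>carrier := H\<rparr> Mod N \<cong> alt_group 5" and "num_subgroups (G\<lparr>carrier := H\<rparr> Mod N) = 59"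
    using few_subgroups_group.iso_alt_group_5_and_59 by blast+
  then have "H = carrier G \<and> N = {\<one>\<^bsub>G\<^esub>}" using sec(2) assms(4) by simp
  then have "G Mod {\<one>\<^bsub>G\<^esub>} \<cong> alt_group 5" using iso by simp
  moreover have "G Mod {\<one>\<^bsub>G\<^esub>} \<cong> G" using trivial_factor_iso by (rule is_isoI)
  then have "G \<cong> G Mod {\<one>\<^bsub>G\<^esub>}"
    using group.iso_sym normal.factorgroup_is_group[OF one_is_normal] by blast
  ultimately show ?thesis using iso_trans by blast
qed

end
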